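(* (a) Let $(X,Y)\sim$ BVHCM with density function $f$ on $(0,\infty)^2$. Then the conditional density $f_{X|Y=y}$ (for every fixed $y>0$), the marginal density $f_X$, and the density $f_{X/Y}$ of the quotient $X/Y$ are all HCM. (b) If $(X_1,X_2)\sim$ BVHCM, then $(X_1^{-1},X_2^{-1})\sim$ BVHCM. (c) If $(X_1,X_2)\sim$ BVHCM, then $(X_1^{q},X_2^{q})\sim$ BVHCM for every real $q$ with $|q|\ge 1$.
   Context: A nonnegative function $h$ on $(0,\infty)$ is HCM (hyperbolically completely monotone) if for every fixed $u>0$ the product $h(uv)h(u/v)$ is completely monotone as a function of $w=v+1/v$, i.e. for each $u>0$ there is a nonnegative Borel measure $\nu$ on $[0,\infty)$ (depending on $u$) with $h(uv)h(u/v)=\int e^{-\lambda(v+1/v)}\,d\nu(\lambda)$ for all $v>0$. A nonnegative function $f$ on $(0,\infty)^2$ is BVHCM (bivariate HCM) if for all fixed $u_1,u_2>0$ the product $f(u_1v_1,u_2v_2)f(u_1/v_1,u_2/v_2)$ is completely monotone as a function of $w_1=v_1+1/v_1$, $w_2=v_2+1/v_2$, $w_3=v_1/v_2+v_2/v_1$, i.e. for all $u_1,u_2>0$ there is a nonnegative Borel measure $\nu$ on $[0,\infty)^3$ (depending on $u_1,u_2$) such that for all $v_1,v_2>0$ $$f(u_1v_1,u_2v_2)f(u_1/v_1,u_2/v_2)=\int e^{-\lambda_1w_1-\lambda_2w_2-\lambda_3w_3}\,d\nu(\lambda_1,\lambda_2,\lambda_3).$$ A random vector with values in $(0,\infty)^2$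 is $\sim$ BVHCM if it has a probability density function which is BVHCM; $f$ denotes this version of the density. The densities in (a) are the functions on $(0,\infty)$ given by $f_{X|Y=y}(x)=f(x,y)$ (up to a normalizing constant depending on $y$), $f_X(x)=\int_0^\infty f(x,y)\,dy$, and $f_{X/Y}(z)=\int_0^\infty y\,f(zy,y)\,dy$. *)

theory Defs
  imports "HOL-Probability.Probability"
begin

text \<open>Densities are valued in \<^typ>\<open>ennreal\<close>, so that an integral is never silently replaced by a
  default value when it diverges; being a real-valued function is an explicit requirement in both
  notions below. Values outside the open half-line (quadrant) play no role.\<close>

definition HCM :: "(real \<Rightarrow> ennreal) \<Rightarrow> bool" where
  "HCM h \<longleftrightarrow>
     (\<forall>x>0. h x < \<infinity>) \<and>
     (\<forall>u>0. \<exists>\<nu> :: real measure.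
        sets \<nu> = sets (restrict_space borel {0..}) \<and>
        (\<forall>v>0. h (u * v) * h (u / v) =
           (\<integral>\<^sup>+ l. ennreal (exp (- l * (v + 1 / v))) \<partial>\<nu>)))"

definition BVHCM :: "(real \<times> real \<Rightarrow> ennreal) \<Rightarrow> bool" where
  "BVHCM f \<longleftrightarrow>
     (\<forall>x>0. \<forall>y>0. f (x, y) < \<infinity>) \<and>
     (\<forall>u1>0. \<forall>u2>0. \<exists>\<nu> :: (real \<times> real \<times> real) measure.
        sets \<nu> = sets (restrict_space borel ({0..} \<times> {0..} \<times> {0..})) \<and>
        (\<forall>v1>0. \<forall>v2>0. f (u1 * v1, u2 * v2) * f (u1 / v1, u2 / v2) =
           (\<integral>\<^sup>+ (l1, l2, l3). ennreal (exp (- l1 * (v1 + 1 / v1) - l2 * (v2 + 1 / v2)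
                                              - l3 * (v1 / v2 + v2 / v1))) \<partial>\<nu>)))"

text \<open>Lebesgue measure on the open quadrant. Measurability of a random vector into this space
  includes that all its values lie in the quadrant.\<close>

definition quadrant :: "(real \<times> real) measure" where
  "quadrant = restrict_space lborel ({0<..} \<times> {0<..})"

definition has_BVHCM_density ::
    "'a measure \<Rightarrow> ('a \<Rightarrow> real \<times> real) \<Rightarrow> (real \<times> real \<Rightarrow> ennreal) \<Rightarrow> bool" where
  "has_BVHCM_density M Z f \<longleftrightarrow> distributed M quadrant Z f \<and> BVHCM f"

definition BVHCM_vector :: "'a measure \<Rightarrow> ('a \<Rightarrow> real \<times> real) \<Rightarrow> bool" where
  "BVHCM_vector M Z \<longleftrightarrow> (\<exists>f. has_BVHCM_density M Z f)"

definition conditional_density :: "(real \<times> real \<Rightarrow> ennreal) \<Rightarrow> real \<Rightarrow> real \<Rightarrow> ennreal" where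
  "conditional_density f y x = f (x, y) / (\<integral>\<^sup>+ t\<in>{0<..}. f (t, y) \<partial>lborel)"

definition marginal_density :: "(real \<times> real \<Rightarrow> ennreal) \<Rightarrow> real \<Rightarrow> ennreal" where
  "marginal_density f x = (\<integral>\<^sup>+ y\<in>{0<..}. f (x, y) \<partial>lborel)"

definition quotient_density :: "(real \<times> real \<Rightarrow> ennreal) \<Rightarrow> real \<Rightarrow> ennreal" where
  "quotient_density f z = (\<integral>\<^sup>+ y\<in>{0<..}. ennreal y * f (z * y, y) \<partial>lborel)"

end

theory Submission
  imports Defs
begin

text \<open>In logarithmic coordinates the products in the definitions become Laplace transforms in
  \<open>2 cosh b - 2\<close>, evaluated at \<open>b1\<close>, \<open>b2\<close> and \<open>b1 - b2\<close>.

  For a marginal density, the product of its values at \<open>a + b\<close> and \<open>a - b\<close> is an integral over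
  \<open>(y, z) = (r + q, r - q)\<close>. For fixed \<open>r\<close> the integral over \<open>q\<close> is of Bessel type and becomes,
  after a translation, a Laplace transform in \<open>2 cosh b - 2\<close>; it remains to integrate over \<open>r\<close>.
  Conditional densities are sections, and the quotient density is the marginal of a sheared BVHCM
  function. Marginals and normalising constants are finite for every, not merely almost every, value
  of the variable, because a BVHCM function is dominated on each half of a line by a multiple of its
  restriction to a parallel line.

  For powers, let \<open>p = 1 / q\<close>. If \<open>0 < p \<le> 1\<close> then \<open>2 cosh (p b) - 2\<close> is a Bernstein function of
  \<open>2 cosh b - 2\<close>, so each exponential \<open>exp (- l (2 cosh (p b) - 2))\<close> is a Laplace transform in
  \<open>2 cosh b - 2\<close> and the representing measure can be mixed accordingly. Negative powers, in particular
  inverses, add a reflection, under which the representing measure is unchanged.\<close>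

section \<open>Laplace transforms of finite measures\<close>

text \<open>The hypotheses only assert that a representing measure exists for each centre
  separately, and integrating over a parameter does not preserve such a statement unless the
  measures can be chosen measurably. This obstacle shapes the proof: every kernel that is integrated
  is built from transforms in one variable on the half-line, where the transform determines the
  measure. Subtracting 2 from \<open>v + 1 / v\<close> makes the representing measures finite, as
  the moment and compactness arguments require. The bound on q enters through p = 1 / q: for p > 1,
  cosh (p b) grows faster than cosh b, so it is not concave as a function of cosh b and cannot be a
  Bernstein function of it. Since divergent integrals stay visible in \<open>ennreal\<close>,
  finiteness of a marginal at every point is a genuine claim, of which Fubini yields only the almost
  everywhere version.\<close>

text \<open>By Bernstein's theorem this is complete monotonicity on \<open>[0, \<infinity>)\<close>. Nothing is required for
  \<open>s < 0\<close>.\<close>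

definition cm :: "(real \<Rightarrow> ennreal) \<Rightarrow> bool" where
  "cm \<phi> \<longleftrightarrow> (\<exists>P. sets P = sets borel \<and> finite_measure P \<and> (AE l in P. 0 \<le> l) \<and>
     (\<forall>s\<ge>0. \<phi> s = (\<integral>\<^sup>+ l. ennreal (exp (- l * s)) \<partial>P)))"

text \<open>The image under \<open>a\<close> of the measure with density \<open>c\<close> represents
  \<open>\<phi>\<close>. In this form, weights and rates may live on an arbitrary space.\<close>

lemma cmI:
  assumes [measurable]: "c \<in> borel_measurable M" "a \<in> borel_measurable M"
    and a: "AE x in M. 0 \<le> a x" and fin: "(\<integral>\<^sup>+ x. c x \<partial>M) < \<infinity>"
    and eq: "\<And>s. 0 \<le> s \<Longrightarrow> \<phi> s = (\<integral>\<^sup>+ x. c x * ennreal (exp (- a x * s)) \<partial>M)"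
  shows "cm \<phi>"
  unfolding cm_def
proof (intro exI conjI allI impI)
  let ?P = "distr (density M c) borel a"
  show "sets ?P = sets borel" by simp
  show "finite_measure ?P"
    using fin by (intro finite_measureI) (simp add: emeasure_distr emeasure_density)
  show "AE l in ?P. 0 \<le> l"
    using a by (auto simp: AE_distr_iff AE_density)
  show "\<phi> s = (\<integral>\<^sup>+ l. ennreal (exp (- l * s)) \<partial>?P)" if "0 \<le> s" for s
    using eq[OF that] by (simp add: nn_integral_distr nn_integral_density)
qed

lemma cm_finite:
  assumes "cm \<phi>" "0 \<le> s"
  shows "\<phi> s < \<infinity>" "\<phi> s \<le> \<phi> 0"
proof -
  obtain P where P: "sets P = sets borel" "finite_measure P" "AE l in P. 0 \<le> l"
    "\<And>s. 0 \<le> s \<Longrightarrow> \<phi> s = (\<integral>\<^sup>+ l. ennreal (exp (- l * s)) \<partial>P)"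
    using assms(1) unfolding cm_def by blast
  show le: "\<phi> s \<le> \<phi> 0"
    unfolding P(4)[OF assms(2)] P(4)[OF order_refl]
    using P(3) assms(2) by (intro nn_integral_mono_AE) (auto elim!: eventually_mono)
  have "\<phi> 0 < \<infinity>"
    using finite_measure.emeasure_finite[OF P(2)] by (simp add: P(4) top.not_eq_extremum)
  with le show "\<phi> s < \<infinity>" by (rule le_less_trans)
qed

text \<open>By Weierstrass it suffices to treat polynomials in \<open>exp (- l)\<close>, whose integrals are values of the
  Laplace transform at natural numbers.\<close>

lemma measurable_integral_of_moments:
  fixes P :: "'t \<Rightarrow> real measure" and g :: "real \<Rightarrow> real"
  assumes P: "\<And>t. t \<in> space M \<Longrightarrow> sets (P t) = sets borel"
      "\<And>t. t \<in> space M \<Longrightarrow> finite_measure (P t)"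
      "\<And>t. t \<in> space M \<Longrightarrow> AE l in P t. 0 \<le> l"
    and meas: "\<And>s. 0 \<le> s \<Longrightarrow> (\<lambda>t. \<integral>\<^sup>+ l. ennreal (exp (- l * s)) \<partial>P t) \<in> borel_measurable M"
    and g: "continuous_on UNIV g"
  shows "(\<lambda>t. \<integral>l. g (exp (- l)) \<partial>P t) \<in> borel_measurable M"
proof -
  have gm [measurable]: "g \<in> borel_measurable borel"
    using g by (rule borel_measurable_continuous_onI)
  have "\<exists>a n. \<forall>x\<in>{0..1}. \<bar>g x - (\<Sum>i\<le>n::nat. a i * x ^ i)\<bar> < 1 / Suc m" for m
  proof -
    obtain p where "real_polynomial_function p" "\<And>x. x \<in> {0..1} \<Longrightarrow> \<bar>g x - p x\<bar> < 1 / Suc m"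
      using Stone_Weierstrass_real_polynomial_function[of "{0..1::real}" g "1 / Suc m"]
        continuous_on_subset[OF g] by auto
    then show ?thesis
      unfolding real_polynomial_function_iff_sum by fastforce
  qed
  then obtain a n where an: "\<And>m x. x \<in> {0..1} \<Longrightarrow>
      \<bar>g x - (\<Sum>i\<le>n m::nat. a m i * x ^ i)\<bar> < 1 / Suc m"
    by metis
  define p where "p m x = (\<Sum>i\<le>n m::nat. a m i * x ^ i)" for m and x :: real
  have pm [measurable]: "p m \<in> borel_measurable borel" for m
    unfolding p_def by measurable
  have int_pow: "integrable (P t) (\<lambda>l. exp (- l) ^ i)" if t: "t \<in> space M" for t i
  proof -
    interpret finite_measure "P t" using P(2)[OF t] .
    note [measurable_cong] = P(1)[OF t]
    show ?thesis
      using P(3)[OF t] by (intro integrable_const_bound[where B=1]) (auto simp: power_le_one)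
  qed
  have "(\<lambda>t. \<integral>l. p m (exp (- l)) \<partial>P t) \<in> borel_measurable M" for m
  proof -
    have eq: "(\<integral>l. p m (exp (- l)) \<partial>P t) =
        (\<Sum>i\<le>n m. a m i * enn2real (\<integral>\<^sup>+ l. ennreal (exp (- l * real i)) \<partial>P t))"
      if t: "t \<in> space M" for t
    proof -
      note [measurable_cong] = P(1)[OF t]
      have "(\<integral>l. p m (exp (- l)) \<partial>P t) = (\<Sum>i\<le>n m. a m i * (\<integral>l. exp (- l) ^ i \<partial>P t))"
        unfolding p_def using int_pow[OF t] by (simp add: Bochner_Integration.integral_sum)
      moreover have "(\<integral>l. exp (- l) ^ i \<partial>P t) = enn2real (\<integral>\<^sup>+ l. ennreal (exp (- l * real i)) \<partial>P t)" for i
        by (subst integral_eq_nn_integral) (auto simp: exp_of_nat_mult[symmetric] mult.commute)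
      ultimately show ?thesis by simp
    qed
    show ?thesis
      by (subst measurable_cong[OF eq], assumption,
        intro borel_measurable_sum borel_measurable_times borel_measurable_const
          borel_measurable_enn2real meas of_nat_0_le_iff)
  qed
  moreover have "(\<lambda>m. \<integral>l. p m (exp (- l)) \<partial>P t) \<longlonglongrightarrow> (\<integral>l. g (exp (- l)) \<partial>P t)"
    if t: "t \<in> space M" for t
  proof -
    interpret finite_measure "P t" using P(2)[OF t] .
    note [measurable_cong] = P(1)[OF t]
    have bd: "AE l in P t. \<bar>g (exp (- l)) - p m (exp (- l))\<bar> \<le> 1 / Suc m" for m
      using P(3)[OF t]
    proof eventually_elim
      case (elim l)
      then have "exp (- l) \<in> {0..1}" by simp
      from an[OF this, of m] show ?case unfolding p_def by linarith
    qed
    have ip: "integrable (P t) (\<lambda>l. p m (exp (- l)))" for m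
      unfolding p_def using int_pow[OF t] by auto
    have idiff: "integrable (P t) (\<lambda>l. g (exp (- l)) - p m (exp (- l)))" for m
      using bd[of m] by (intro integrable_const_bound[where B="1 / Suc m"]) auto
    have ig: "integrable (P t) (\<lambda>l. g (exp (- l)))"
      using Bochner_Integration.integrable_add[OF idiff[of 0] ip[of 0]] by simp
    \<comment> \<open>The approximation is uniform in l but is multiplied by the mass of
      \<open>P t\<close>, so the convergence is only pointwise in t; that is enough for
      measurability.\<close>
    have bound: "norm ((\<integral>l. p m (exp (- l)) \<partial>P t) - (\<integral>l. g (exp (- l)) \<partial>P t))
        \<le> measure (P t) (space (P t)) / Suc m" for m
    proof -
      have "norm ((\<integral>l. p m (exp (- l)) \<partial>P t) - (\<integral>l. g (exp (- l)) \<partial>P t))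
          = \<bar>\<integral>l. g (exp (- l)) - p m (exp (- l)) \<partial>P t\<bar>"
        by (simp only: Bochner_Integration.integral_diff[OF ig ip] real_norm_def abs_minus_commute)
      also have "\<dots> \<le> (\<integral>l. \<bar>g (exp (- l)) - p m (exp (- l))\<bar> \<partial>P t)"
        by (rule integral_abs_bound)
      also have "\<dots> \<le> (\<integral>l. 1 / Suc m \<partial>P t)"
        using bd[of m] idiff by (intro integral_mono_AE) auto
      finally show ?thesis by (simp add: mult.commute)
    qed
    have "(\<lambda>m. measure (P t) (space (P t)) / Suc m) \<longlonglongrightarrow> 0"
      using tendsto_mult[OF tendsto_const LIMSEQ_inverse_real_of_nat, of "measure (P t) (space (P t))"]
      by (simp add: divide_inverse)
    then have "(\<lambda>m. (\<integral>l. p m (exp (- l)) \<partial>P t) - (\<integral>l. g (exp (- l)) \<partial>P t)) \<longlonglongrightarrow> 0"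
      by (rule Lim_null_comparison[OF always_eventually[OF allI[OF bound]]])
    then show ?thesis by (rule LIM_zero_cancel)
  qed
  ultimately show ?thesis
    by (rule borel_measurable_LIMSEQ_real[rotated]) 
qed

text \<open>In the variable x = exp (- l) the half-line \<open>{c..}\<close> becomes x \<le> exp (-
  c), whose indicator is the limit of the continuous ramps \<open>g m\<close>, equal to 1 up to exp
  (- c) and then falling to 0 with slope - m. Such half-lines generate the Borel sets.\<close>

lemma laplace_measures_measurable:
  fixes P :: "'t \<Rightarrow> real measure"
  assumes P: "\<And>t. t \<in> space M \<Longrightarrow> sets (P t) = sets borel"
      "\<And>t. t \<in> space M \<Longrightarrow> finite_measure (P t)"
      "\<And>t. t \<in> space M \<Longrightarrow> AE l in P t. 0 \<le> l"
    and meas: "\<And>s. 0 \<le> s \<Longrightarrow> (\<lambda>t. \<integral>\<^sup>+ l. ennreal (exp (- l * s)) \<partial>P t) \<in> borel_measurable M"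
  shows "(\<lambda>t. emeasure (P t) {c..}) \<in> borel_measurable M"
proof (cases "c \<le> 0")
  case True
  have eq: "emeasure (P t) {c..} = (\<integral>\<^sup>+ l. ennreal (exp (- l * 0)) \<partial>P t)" if t: "t \<in> space M" for t
  proof -
    have "emeasure (P t) {c..} = emeasure (P t) (space (P t))"
      using P(3)[OF t] True P(1)[OF t] by (intro emeasure_eq_AE) auto
    then show ?thesis by simp
  qed
  then show ?thesis
    using meas[of 0] by (subst measurable_cong[OF eq]) auto
next
  case False
  define g where "g m x = max 0 (min 1 (1 - real m * (x - exp (- c))))" for m and x :: real
  have gc: "continuous_on UNIV (g m)" for m
    unfolding g_def by (intro continuous_intros)
  have gm [measurable]: "g m \<in> borel_measurable borel" for m
    using gc by (rule borel_measurable_continuous_onI)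
  have "(\<lambda>m. \<integral>l. g m (exp (- l)) \<partial>P t) \<longlonglongrightarrow> measure (P t) {c..}" if t: "t \<in> space M" for t
  proof -
    interpret finite_measure "P t" using P(2)[OF t] .
    note [measurable_cong] = P(1)[OF t]
    have "(\<lambda>m. \<integral>l. g m (exp (- l)) \<partial>P t) \<longlonglongrightarrow> (\<integral>l. indicator {c..} l \<partial>P t)"
    proof (rule integral_dominated_convergence[where w="\<lambda>_. 1"])
      have "(\<lambda>m. g m (exp (- l))) \<longlonglongrightarrow> indicator {c..} l" for l
      proof (cases "c \<le> l")
        case True
        then have "g m (exp (- l)) = 1" for m
          unfolding g_def by (simp add: mult_nonneg_nonpos max_def min_def)
        then show ?thesis using True by simp
      next
        case False
        then have pos: "0 < exp (- l) - exp (- c)" by simp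
        then obtain N :: nat where N: "1 < real N * (exp (- l) - exp (- c))"
          using ex_less_of_nat_mult by blast
        have "g m (exp (- l)) = 0" if "N \<le> m" for m
        proof -
          have "real N * (exp (- l) - exp (- c)) \<le> real m * (exp (- l) - exp (- c))"
            using that pos by (intro mult_right_mono) auto
          then show ?thesis using N unfolding g_def by auto
        qed
        then have "eventually (\<lambda>m. g m (exp (- l)) = 0) sequentially"
          unfolding eventually_sequentially by blast
        then show ?thesis using False by (simp add: tendsto_eventually)
      qed
      then show "AE l in P t. (\<lambda>m. g m (exp (- l))) \<longlonglongrightarrow> indicator {c..} l" by simp
      show "AE l in P t. norm (g m (exp (- l))) \<le> 1" for m by (simp add: g_def)
    qed auto
    then show ?thesis
      using P(1)[OF t] by simp
  qed
  then have "(\<lambda>t. measure (P t) {c..}) \<in> borel_measurable M"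
    using measurable_integral_of_moments[OF P meas gc]
    by (rule borel_measurable_LIMSEQ_real)
  moreover have eq: "emeasure (P t) {c..} = ennreal (measure (P t) {c..})" if "t \<in> space M" for t
    using P(2)[OF that] by (simp add: finite_measure.emeasure_eq_measure)
  ultimately show ?thesis
    by (subst measurable_cong[OF eq]) (auto intro: measurable_compose)
qed

text \<open>The representing measures are chosen separately for each \<open>t\<close>; being determined by their Laplace
  transforms, they nevertheless form a measurable kernel.\<close>

lemma laplace_kernel:
  assumes cm: "\<And>t. t \<in> space M \<Longrightarrow> cm (\<phi> t)"
    and meas: "\<And>s. 0 \<le> s \<Longrightarrow> (\<lambda>t. \<phi> t s) \<in> borel_measurable M"
  obtains \<kappa> where "\<kappa> \<in> M \<rightarrow>\<^sub>M subprob_algebra borel"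
    "\<And>t. t \<in> space M \<Longrightarrow> AE l in \<kappa> t. 0 \<le> l"
    "\<And>t s. t \<in> space M \<Longrightarrow> 0 \<le> s \<Longrightarrow> \<phi> t s = \<phi> t 0 * (\<integral>\<^sup>+ l. ennreal (exp (- l * s)) \<partial>\<kappa> t)"
proof -
  have "\<forall>t\<in>space M. \<exists>P. sets P = sets borel \<and> finite_measure P \<and> (AE l in P. 0 \<le> l) \<and>
     (\<forall>s\<ge>0. \<phi> t s = (\<integral>\<^sup>+ l. ennreal (exp (- l * s)) \<partial>P))"
    using cm unfolding cm_def by blast
  then obtain P where P0: "\<forall>t\<in>space M. sets (P t) = sets borel \<and> finite_measure (P t) \<and>
     (AE l in P t. 0 \<le> l) \<and> (\<forall>s\<ge>0. \<phi> t s = (\<integral>\<^sup>+ l. ennreal (exp (- l * s)) \<partial>P t))"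
    by metis
  have P: "\<And>t. t \<in> space M \<Longrightarrow> sets (P t) = sets borel"
      "\<And>t. t \<in> space M \<Longrightarrow> finite_measure (P t)"
      "\<And>t. t \<in> space M \<Longrightarrow> AE l in P t. 0 \<le> l"
      "\<And>t s. t \<in> space M \<Longrightarrow> 0 \<le> s \<Longrightarrow> \<phi> t s = (\<integral>\<^sup>+ l. ennreal (exp (- l * s)) \<partial>P t)"
    using P0 by blast+
  \<comment> \<open>Dividing by the mass gives a probability measure unless the mass is 0. In that
    case the factor is infinite but \<open>P t\<close> is null, so \<open>\<kappa> t\<close> is the
    zero measure; hence a subprobability kernel.\<close>
  define \<kappa> where "\<kappa> t = density (P t) (\<lambda>_. inverse (\<phi> t 0))" for t
  have em: "emeasure (\<kappa> t) A = inverse (\<phi> t 0) * emeasure (P t) A"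
    if "t \<in> space M" "A \<in> sets borel" for t A
    using P(1)[OF that(1)] that(2) by (simp add: \<kappa>_def emeasure_density nn_integral_cmult_indicator)
  have sets: "sets (\<kappa> t) = sets borel" if "t \<in> space M" for t
    using P(1)[OF that] by (simp add: \<kappa>_def)
  have P_UNIV: "emeasure (P t) UNIV = \<phi> t 0" if "t \<in> space M" for t
    using P(4)[OF that, of 0] sets_eq_imp_space_eq[OF P(1)[OF that]] by simp
  have meas0 [measurable]: "(\<lambda>t. \<phi> t 0) \<in> borel_measurable M"
    by (rule meas) simp
  have "\<kappa> \<in> M \<rightarrow>\<^sub>M subprob_algebra borel"
  proof (rule measurable_subprob_algebra_generated[where \<Omega>=UNIV and G="range atLeast"])
    show "sets borel = sigma_sets UNIV (range (atLeast :: real \<Rightarrow> _))"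
      by (subst borel_Ici) simp
    show "Int_stable (range (atLeast :: real \<Rightarrow> _))"
      proof (rule Int_stableI)
      fix A B :: "real set"
      assume "A \<in> range atLeast" "B \<in> range atLeast"
      then obtain a b where "A = {a..}" "B = {b..}" by auto
      then have "A \<inter> B = {max a b..}" by auto
      then show "A \<inter> B \<in> range atLeast" by blast
    qed
    show "subprob_space (\<kappa> t)" if t: "t \<in> space M" for t
    proof
      have "space (\<kappa> t) = UNIV"
        using sets_eq_imp_space_eq[OF sets[OF t]] by simp
      then show "space (\<kappa> t) \<noteq> {}" by simp
      have "inverse (\<phi> t 0) * \<phi> t 0 \<le> 1"
        by (cases "\<phi> t 0 = 0 \<or> \<phi> t 0 = \<infinity>")
          (use cm_finite(1)[OF cm[OF t], of 0] in \<open>auto simp: ennreal_inverse_mult less_top[symmetric] mult.commute ennreal_divide_self divide_ennreal_def[symmetric]\<close>)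
      then show "emeasure (\<kappa> t) (space (\<kappa> t)) \<le> 1"
        using \<open>space (\<kappa> t) = UNIV\<close> em[OF t] P_UNIV[OF t] by simp
    qed
    show "sets (\<kappa> t) = sets borel" if "t \<in> space M" for t
      using sets[OF that] .
    show "(\<lambda>t. emeasure (\<kappa> t) A) \<in> borel_measurable M" if "A \<in> range atLeast" for A
    proof -
      from that obtain c where A: "A = {c..}" by auto
      have [measurable]: "(\<lambda>t. emeasure (P t) {c..}) \<in> borel_measurable M"
      proof (rule laplace_measures_measurable[OF P(1-3)])
        show "(\<lambda>t. \<integral>\<^sup>+ l. ennreal (exp (- l * s)) \<partial>P t) \<in> borel_measurable M" if "0 \<le> s" for s
          using meas[OF that] by (subst measurable_cong[OF P(4)[OF _ that, symmetric]])
      qed auto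
      show ?thesis
        by (subst measurable_cong[OF em]) (auto simp: A)
    qed
    show "(\<lambda>t. emeasure (\<kappa> t) UNIV) \<in> borel_measurable M"
      by (subst measurable_cong[OF em]) (auto simp: P_UNIV cong: measurable_cong)
  qed auto
  moreover have "AE l in \<kappa> t. 0 \<le> l" if t: "t \<in> space M" for t
    using P(3)[OF t] P(1)[OF t] unfolding \<kappa>_def by (subst AE_density) auto
  moreover have "\<phi> t s = \<phi> t 0 * (\<integral>\<^sup>+ l. ennreal (exp (- l * s)) \<partial>\<kappa> t)"
    if t: "t \<in> space M" and s: "0 \<le> s" for t s
  proof -
    note [measurable_cong] = P(1)[OF t]
    have "(\<integral>\<^sup>+ l. ennreal (exp (- l * s)) \<partial>\<kappa> t) = inverse (\<phi> t 0) * \<phi> t s"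
      unfolding \<kappa>_def P(4)[OF t s] by (subst nn_integral_density) (auto simp: nn_integral_cmult)
    moreover have "\<phi> t s = \<phi> t 0 * (inverse (\<phi> t 0) * \<phi> t s)"
    proof (cases "\<phi> t 0 = 0")
      case True
      then show ?thesis using cm_finite(2)[OF cm[OF t] s] by simp
    next
      case False
      then show ?thesis
        using cm_finite(1)[OF cm[OF t], of 0]
        by (metis ennreal_divide_self divide_ennreal_def infinity_ennreal_def less_top mult.assoc mult_1 order_refl)
    qed
    ultimately show ?thesis by simp
  qed
  ultimately show ?thesis using that by blast
qed

section \<open>Mixtures, products, exponentials and limits of Laplace transforms\<close>

lemma cm_zero: "cm (\<lambda>s. 0)"
  by (rule cmI[where M="count_space {()}" and c="\<lambda>_. 0" and a="\<lambda>_. 0"]) auto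

text \<open>With the masses \<open>\<phi> t 0\<close> as density on M, binding the kernel of
  normalised measures gives the representing measure of the mixture. The hypothesis is an almost
  everywhere one because for marginals the inner integral is known to be finite only for almost
  every r.\<close>

lemma cm_mixture:
  assumes ae: "AE t in M. cm (\<phi> t)"
    and meas: "\<And>s. 0 \<le> s \<Longrightarrow> (\<lambda>t. \<phi> t s) \<in> borel_measurable M"
    and fin: "(\<integral>\<^sup>+ t. \<phi> t 0 \<partial>M) < \<infinity>"
    and eq: "\<And>s. 0 \<le> s \<Longrightarrow> \<psi> s = (\<integral>\<^sup>+ t. \<phi> t s \<partial>M)"
  shows "cm \<psi>"
proof (cases "space M = {}")
  \<comment> \<open>\<open>bind\<close> over an empty space is \<open>count_space {}\<close>, which
    is not a measure on the reals.\<close>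
  case True
  then have "\<And>s. 0 \<le> s \<Longrightarrow> \<psi> s = 0" by (simp add: eq nn_integral_empty)
  then show ?thesis using cm_zero unfolding cm_def by simp
next
  case False
  \<comment> \<open>The kernel needs \<open>cm\<close> at every t, so the functions are replaced by
    0 on a measurable null set covering the exceptions.\<close>
  obtain N where N: "{t \<in> space M. \<not> cm (\<phi> t)} \<subseteq> N" "N \<in> null_sets M"
    using ae by (auto elim: AE_E simp: null_sets_def)
  then have [measurable]: "N \<in> sets M" by auto
  define \<phi>' where "\<phi>' t s = (if t \<in> N then 0 else \<phi> t s)" for t s
  have meas' [measurable]: "(\<lambda>t. \<phi>' t s) \<in> borel_measurable M" if "0 \<le> s" for s
    unfolding \<phi>'_def using meas[OF that] by measurable
  have ae': "AE t in M. \<phi>' t s = \<phi> t s" for s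
    using AE_not_in[OF N(2)] by eventually_elim (simp add: \<phi>'_def)
  have cm': "cm (\<phi>' t)" if "t \<in> space M" for t
  proof (cases "t \<in> N")
    case True
    then have "\<phi>' t = (\<lambda>s. 0)" by (simp add: \<phi>'_def fun_eq_iff)
    then show ?thesis using cm_zero by simp
  next
    case False
    then have "\<phi>' t = \<phi> t" by (simp add: \<phi>'_def fun_eq_iff)
    then show ?thesis using False N(1) that by auto
  qed
  obtain \<kappa> where \<kappa>: "\<kappa> \<in> M \<rightarrow>\<^sub>M subprob_algebra borel"
    "\<And>t. t \<in> space M \<Longrightarrow> AE l in \<kappa> t. 0 \<le> l"
    "\<And>t s. t \<in> space M \<Longrightarrow> 0 \<le> s \<Longrightarrow> \<phi>' t s = \<phi>' t 0 * (\<integral>\<^sup>+ l. ennreal (exp (- l * s)) \<partial>\<kappa> t)"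
    using laplace_kernel[of M \<phi>', OF cm' meas'] by blast
  note [measurable] = \<kappa>(1) meas'[OF order_refl]
  let ?D = "density M (\<lambda>t. \<phi>' t 0)"
  have \<kappa>D: "\<kappa> \<in> ?D \<rightarrow>\<^sub>M subprob_algebra borel" by simp
  have sets_bind': "sets (?D \<bind> \<kappa>) = sets borel"
    using False subprob_measurableD(2)[OF \<kappa>(1)] by (intro sets_bind) auto
  note [measurable_cong] = sets_bind'
  have int: "(\<integral>\<^sup>+ l. ennreal (exp (- l * s)) \<partial>(?D \<bind> \<kappa>)) = (\<integral>\<^sup>+ t. \<phi> t s \<partial>M)" if s: "0 \<le> s" for s
  proof -
    have [measurable]: "(\<lambda>t. \<integral>\<^sup>+ l. ennreal (exp (- l * s)) \<partial>\<kappa> t) \<in> borel_measurable M"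
      by (rule measurable_compose[OF \<kappa>(1) nn_integral_measurable_subprob_algebra]) measurable
    have "(\<integral>\<^sup>+ l. ennreal (exp (- l * s)) \<partial>(?D \<bind> \<kappa>))
        = (\<integral>\<^sup>+ t. \<integral>\<^sup>+ l. ennreal (exp (- l * s)) \<partial>\<kappa> t \<partial>?D)"
      by (rule nn_integral_bind[OF _ \<kappa>D]) measurable
    also have "\<dots> = (\<integral>\<^sup>+ t. \<phi>' t 0 * (\<integral>\<^sup>+ l. ennreal (exp (- l * s)) \<partial>\<kappa> t) \<partial>M)"
      by (rule nn_integral_density) measurable
    also have "\<dots> = (\<integral>\<^sup>+ t. \<phi>' t s \<partial>M)"
      by (intro nn_integral_cong \<kappa>(3)[symmetric] s)
    also have "\<dots> = (\<integral>\<^sup>+ t. \<phi> t s \<partial>M)"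
      by (rule nn_integral_cong_AE[OF ae'])
    finally show ?thesis .
  qed
  show ?thesis
  proof (rule cmI[where M="?D \<bind> \<kappa>" and c="\<lambda>_. 1" and a="\<lambda>l. l"])
    show "AE l in ?D \<bind> \<kappa>. 0 \<le> l"
      by (subst AE_bind[OF \<kappa>D]) (auto simp: \<kappa>(2))
    show "(\<integral>\<^sup>+ l. 1 \<partial>(?D \<bind> \<kappa>)) < \<infinity>"
      using int[of 0] fin by simp
    show "\<psi> s = (\<integral>\<^sup>+ l. 1 * ennreal (exp (- l * s)) \<partial>(?D \<bind> \<kappa>))" if "0 \<le> s" for s
      using int[OF that] eq[OF that] by simp
  qed measurable
qed

lemma cm_cmult:
  assumes "cm \<phi>" "c < \<infinity>"
  shows "cm (\<lambda>s. c * \<phi> s)"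
proof -
  obtain P where P: "sets P = sets borel" "finite_measure P" "AE l in P. 0 \<le> l"
    "\<And>s. 0 \<le> s \<Longrightarrow> \<phi> s = (\<integral>\<^sup>+ l. ennreal (exp (- l * s)) \<partial>P)"
    using assms(1) unfolding cm_def by blast
  note [measurable_cong] = P(1)
  show ?thesis
  proof (rule cmI[where M=P and c="\<lambda>_. c" and a="\<lambda>l. l"])
    show "(\<integral>\<^sup>+ l. c \<partial>P) < \<infinity>"
      using finite_measure.emeasure_finite[OF P(2)] assms(2)
      by (simp add: ennreal_mult_less_top top.not_eq_extremum)
    show "c * \<phi> s = (\<integral>\<^sup>+ l. c * ennreal (exp (- l * s)) \<partial>P)" if "0 \<le> s" for s
      unfolding P(4)[OF that] by (rule nn_integral_cmult[symmetric]) measurable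
  qed (use P(3) in measurable)
qed

text \<open>The representing measure is the convolution, obtained here as the mixture over l in P of
  the translates of Q by l.\<close>

lemma cm_mult:
  assumes \<phi>: "cm \<phi>" and \<psi>: "cm \<psi>"
  shows "cm (\<lambda>s. \<phi> s * \<psi> s)"
proof -
  obtain P where P: "sets P = sets borel" "finite_measure P" "AE l in P. 0 \<le> l"
    "\<And>s. 0 \<le> s \<Longrightarrow> \<phi> s = (\<integral>\<^sup>+ l. ennreal (exp (- l * s)) \<partial>P)"
    using \<phi> unfolding cm_def by blast
  obtain Q where Q: "sets Q = sets borel" "finite_measure Q" "AE l in Q. 0 \<le> l"
    "\<And>s. 0 \<le> s \<Longrightarrow> \<psi> s = (\<integral>\<^sup>+ l. ennreal (exp (- l * s)) \<partial>Q)"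
    using \<psi> unfolding cm_def by blast
  note [measurable_cong] = P(1) Q(1)
  have int: "\<phi> s * \<psi> s = (\<integral>\<^sup>+ l. ennreal (exp (- l * s)) * \<psi> s \<partial>P)" if "0 \<le> s" for s
    unfolding P(4)[OF that] by (rule nn_integral_multc[symmetric]) measurable
  show ?thesis
  proof (rule cm_mixture[OF _ _ _ int])
    show "AE l in P. cm (\<lambda>s. ennreal (exp (- l * s)) * \<psi> s)"
      using P(3)
    proof eventually_elim
      case (elim l)
      show ?case
      proof (rule cmI[where M=Q and c="\<lambda>_. 1" and a="\<lambda>l'. l + l'"])
        show "AE l' in Q. 0 \<le> l + l'" using Q(3) elim by (auto elim!: eventually_mono)
        show "(\<integral>\<^sup>+ l. 1 \<partial>Q) < \<infinity>"
          using finite_measure.emeasure_finite[OF Q(2)] by (simp add: top.not_eq_extremum)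
        show "ennreal (exp (- l * s)) * \<psi> s = (\<integral>\<^sup>+ l'. 1 * ennreal (exp (- (l + l') * s)) \<partial>Q)"
          if "0 \<le> s" for s
          unfolding Q(4)[OF that]
          by (subst nn_integral_cmult[symmetric])
            (auto simp: ennreal_mult[symmetric] exp_add[symmetric] algebra_simps)
      qed measurable
    qed
    show "(\<integral>\<^sup>+ l. ennreal (exp (- l * 0)) * \<psi> 0 \<partial>P) < \<infinity>"
      using cm_finite(1)[OF \<phi>, of 0] cm_finite(1)[OF \<psi>, of 0] int[of 0]
      by (metis ennreal_mult_less_top infinity_ennreal_def order_refl)
  qed measurable
qed

lemma cm_one: "cm (\<lambda>s. 1)"
  by (rule cmI[where M="count_space {()}" and c="\<lambda>_. 1" and a="\<lambda>_. 0"])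
    (auto simp: nn_integral_count_space_finite)

lemma cm_power:
  assumes "cm \<phi>"
  shows "cm (\<lambda>s. \<phi> s ^ k)"
  by (induction k) (auto simp: cm_one intro: cm_mult assms)

text \<open>The exponential series is a mixture, over the natural numbers with weights 1 / k!, of
  the powers of K.\<close>

lemma cm_exp:
  assumes cm: "cm (\<lambda>s. ennreal (K s))" and K: "\<And>s. 0 \<le> s \<Longrightarrow> 0 \<le> K s"
  shows "cm (\<lambda>s. ennreal (exp (K s)))"
proof -
  have eq: "ennreal (exp (K s)) =
      (\<integral>\<^sup>+ k. ennreal (1 / fact k) * ennreal (K s) ^ k \<partial>count_space UNIV)" if s: "0 \<le> s" for s
  proof -
    have "(\<lambda>k. K s ^ k / fact k) sums exp (K s)"
      using exp_converges[of "K s"] by (simp add: divide_inverse mult.commute)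
    then have "(\<Sum>k. ennreal (K s ^ k / fact k)) = ennreal (exp (K s))"
      using K[OF s] by (intro suminf_ennreal_eq) auto
    then show ?thesis
      using K[OF s]
      by (simp add: nn_integral_count_space_nat ennreal_power ennreal_mult[symmetric])
  qed
  show ?thesis
  proof (rule cm_mixture[OF _ _ _ eq])
    show "AE k in count_space UNIV. cm (\<lambda>s. ennreal (1 / fact k) * ennreal (K s) ^ k)"
      using cm_power[OF cm] by (auto intro!: cm_cmult)
    show "(\<integral>\<^sup>+ k. ennreal (1 / fact k) * ennreal (K 0) ^ k \<partial>count_space UNIV) < \<infinity>"
      using eq[of 0] by (metis ennreal_less_top infinity_ennreal_def order_refl)
  qed auto
qed

text \<open>Helly selection is applied to the images of the representing measures under \<open>l \<mapsto> exp (- l)\<close>, which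
  live on the compact interval \<open>[0, 1]\<close>; continuity of \<open>\<psi>\<close> at \<open>0\<close> excludes an atom at the point \<open>0\<close>,
  that is, mass escaping to infinity.\<close>

lemma cm_limit:
  fixes \<phi> :: "nat \<Rightarrow> real \<Rightarrow> real"
  assumes cm: "\<And>n. cm (\<lambda>s. ennreal (\<phi> n s))" and one: "\<And>n. \<phi> n 0 = 1"
    and nonneg: "\<And>n s. 0 \<le> s \<Longrightarrow> 0 \<le> \<phi> n s"
    and lim: "\<And>s. 0 \<le> s \<Longrightarrow> (\<lambda>n. \<phi> n s) \<longlonglongrightarrow> \<psi> s"
    and cont: "(\<lambda>m. \<psi> (1 / Suc m)) \<longlonglongrightarrow> 1"
  shows "cm (\<lambda>s. ennreal (\<psi> s))"
proof -
  have "\<forall>n. \<exists>P. sets P = sets borel \<and> finite_measure P \<and> (AE l in P. 0 \<le> l) \<and>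
     (\<forall>s\<ge>0. ennreal (\<phi> n s) = (\<integral>\<^sup>+ l. ennreal (exp (- l * s)) \<partial>P))"
    using cm unfolding cm_def by blast
  then obtain P where P: "\<And>n. sets (P n) = sets borel" "\<And>n. finite_measure (P n)"
    "\<And>n. AE l in P n. 0 \<le> l"
    "\<And>n s. 0 \<le> s \<Longrightarrow> ennreal (\<phi> n s) = (\<integral>\<^sup>+ l. ennreal (exp (- l * s)) \<partial>P n)"
    by metis
  note [measurable_cong] = P(1)
  have P_prob: "prob_space (P n)" for n
    using P(4)[of 0 n] one by (intro prob_spaceI) simp
  define Q where "Q n = distr (P n) borel (\<lambda>l. exp (- l))" for n
  have Q_prob: "prob_space (Q n)" for n
    unfolding Q_def by (rule prob_space.prob_space_distr[OF P_prob]) measurable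
  have tight: "tight Q"
    unfolding tight_def
  proof (intro conjI allI impI)
    show "real_distribution (Q n)" for n
      using Q_prob[of n] by (intro real_distribution.intro) (auto simp: real_distribution_axioms_def Q_def)
    fix \<epsilon> :: real assume \<epsilon>: "0 < \<epsilon>"
    show "\<exists>a b. a < b \<and> (\<forall>n. 1 - \<epsilon> < measure (Q n) {a<..b})"
    proof (rule exI[of _ 0], rule exI[of _ 1], intro conjI allI)
      fix n
      interpret Qn: prob_space "Q n" by (rule Q_prob)
      have "AE x in Q n. x \<in> {0<..1}"
        unfolding Q_def using P(3)[of n] by (subst AE_distr_iff) auto
      then have "measure (Q n) {0<..1} = 1"
        by (subst Qn.prob_eq_1) (auto simp: Q_def)
      then show "1 - \<epsilon> < measure (Q n) {0<..1}" using \<epsilon> by simp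
    qed simp
  qed
  obtain r R where r: "strict_mono (r :: nat \<Rightarrow> nat)" and R: "real_distribution R"
    and weak: "weak_conv_m (Q \<circ> id \<circ> r) R"
    using tight_imp_convergent_subsubsequence[OF tight, of id] by (auto simp: strict_mono_def)
  interpret R: real_distribution R by (rule R)
  \<comment> \<open>At x = exp (- l) with l \<ge> 0 this is exp (- l s). Clamping makes it a bounded
    continuous test function on the line, but only for s > 0: since \<open>0 powr 0 = 0\<close>,
    \<open>h 0\<close> jumps at 0. The value at s = 0 is therefore recovered from s = 1 / (m +
    1).\<close>
  define h where "h s x = (max 0 (min 1 x)) powr s" for s x :: real
  have h_cont: "isCont (h s) x" if "0 < s" for s x
    unfolding h_def using that by (intro continuous_intros) auto
  have h_le: "norm (h s x) \<le> 1" if "0 < s" for s x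
    unfolding h_def using that by (auto intro!: powr_le1)
  have hm [measurable]: "h s \<in> borel_measurable borel" for s
    unfolding h_def by measurable
  have int_Q: "integral\<^sup>L (Q n) (h s) = \<phi> n s" if s: "0 < s" for n s
  proof -
    have "integral\<^sup>L (Q n) (h s) = (\<integral>l. h s (exp (- l)) \<partial>P n)"
      unfolding Q_def by (rule integral_distr) measurable
    also have "\<dots> = enn2real (\<integral>\<^sup>+l. ennreal (h s (exp (- l))) \<partial>P n)"
      by (rule integral_eq_nn_integral) (auto simp: h_def)
    also have "(\<integral>\<^sup>+l. ennreal (h s (exp (- l))) \<partial>P n) = (\<integral>\<^sup>+l. ennreal (exp (- l * s)) \<partial>P n)"
      using P(3)[of n]
      by (intro nn_integral_cong_AE) (auto elim!: eventually_mono simp: h_def exp_powr_real)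
    also have "\<dots> = ennreal (\<phi> n s)" using P(4)[of s n] s by simp
    finally show ?thesis using nonneg[of s n] s by simp
  qed
  have int_R: "integral\<^sup>L R (h s) = \<psi> s" if s: "0 < s" for s
  proof -
    have "(\<lambda>n. integral\<^sup>L ((Q \<circ> id \<circ> r) n) (h s)) \<longlonglongrightarrow> integral\<^sup>L R (h s)"
    proof (rule weak_conv_imp_integral_bdd_continuous_conv[OF _ R weak])
      show "real_distribution ((Q \<circ> id \<circ> r) n)" for n
        using tight unfolding tight_def by simp
    qed (use h_cont[OF s] h_le[OF s] R in auto)
    moreover have "(\<lambda>n. integral\<^sup>L ((Q \<circ> id \<circ> r) n) (h s)) \<longlonglongrightarrow> \<psi> s"
      using LIMSEQ_subseq_LIMSEQ[OF lim r, of s] s by (simp add: int_Q o_def)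
    ultimately show ?thesis by (rule LIMSEQ_unique)
  qed
  have "(\<lambda>m. integral\<^sup>L R (h (1 / Suc m))) \<longlonglongrightarrow> integral\<^sup>L R (indicator {0<..})"
  proof (rule integral_dominated_convergence[where w="\<lambda>_. 1"])
    have "(\<lambda>m. h (1 / Suc m) x) \<longlonglongrightarrow> indicator {0<..} x" for x
    proof (cases "0 < x")
      case True
      have "(\<lambda>m. 1 / real (Suc m)) \<longlonglongrightarrow> 0"
        using LIMSEQ_inverse_real_of_nat by (simp add: inverse_eq_divide)
      then have "(\<lambda>m. min 1 x powr (1 / Suc m)) \<longlonglongrightarrow> min 1 x powr 0"
        using True by (intro tendsto_powr tendsto_const) auto
      moreover have "min 1 x \<noteq> 0" "max 0 (min 1 x) = min 1 x" using True by auto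
      ultimately show ?thesis using True by (simp add: h_def)
    qed (simp add: h_def)
    then show "AE x in R. (\<lambda>m. h (1 / Suc m) x) \<longlonglongrightarrow> indicator {0<..} x" by simp
    show "AE x in R. norm (h (1 / Suc m) x) \<le> 1" for m
      by (rule AE_I2, rule h_le) simp
  qed auto
  moreover have "(\<lambda>m. integral\<^sup>L R (h (1 / Suc m))) \<longlonglongrightarrow> 1"
    using cont by (simp add: int_R)
  ultimately have R1: "measure R {0<..} = 1"
    using LIMSEQ_unique by force
  have \<psi>0: "\<psi> 0 = 1"
    using lim[of 0] one LIMSEQ_unique[of "\<lambda>n. 1 :: real"] by force
  show ?thesis
  \<comment> \<open>Points x > 1 count as x = 1, with rate 0, in agreement with the clamping in
    \<open>h\<close>; the weight discards x \<le> 0.\<close>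
  proof (rule cmI[where M=R and c="indicator {0<..}" and a="\<lambda>x. if 0 < x then - ln (min 1 x) else 0"])
    show "(\<integral>\<^sup>+ x. indicator {0<..} x \<partial>R) < \<infinity>"
      by (simp add: R.emeasure_eq_measure)
    show "ennreal (\<psi> s) = (\<integral>\<^sup>+ x. indicator {0<..} x *
        ennreal (exp (- (if 0 < x then - ln (min 1 x) else 0) * s)) \<partial>R)" if s: "0 \<le> s" for s
    proof (cases "s = 0")
      case True
      then show ?thesis using \<psi>0 R1 by (simp add: R.emeasure_eq_measure)
    next
      case False
      with s have s: "0 < s" by simp
      have "integrable R (h s)"
        using h_le[OF s] by (intro R.integrable_const_bound[where B=1]) auto
      then have "ennreal (\<psi> s) = (\<integral>\<^sup>+ x. ennreal (h s x) \<partial>R)"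
        unfolding int_R[OF s, symmetric]
        by (intro nn_integral_eq_integral[symmetric]) (auto simp: h_def)
      also have "\<dots> = (\<integral>\<^sup>+ x. indicator {0<..} x *
        ennreal (exp (- (if 0 < x then - ln (min 1 x) else 0) * s)) \<partial>R)"
        using s by (intro nn_integral_cong) (auto simp: h_def powr_def indicator_def max_def mult.commute)
      finally show ?thesis .
    qed
    show "AE x in R. 0 \<le> (if 0 < x then - ln (min 1 x) else 0)"
      by (rule AE_I2) auto
  qed measurable
qed

lemma cm_cong: "(\<And>s. 0 \<le> s \<Longrightarrow> \<phi> s = \<psi> s) \<Longrightarrow> cm \<phi> \<longleftrightarrow> cm \<psi>"
  unfolding cm_def by auto

lemma nn_integral_exp_atLeast_0:
  fixes k :: real
  assumes "0 < k"
  shows "(\<integral>\<^sup>+ r\<in>{0..}. ennreal (exp (- (k * r))) \<partial>lborel) = ennreal (1 / k)"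
proof -
  have "filterlim (\<lambda>r. k * r) at_top at_top"
    by (rule filterlim_tendsto_pos_mult_at_top[OF tendsto_const assms filterlim_ident])
  then have "((\<lambda>r. exp (- (k * r))) \<longlongrightarrow> 0) at_top"
    by (intro filterlim_compose[OF exp_at_bot]) (simp add: filterlim_uminus_at_bot)
  from tendsto_divide[OF tendsto_minus[OF this] tendsto_const[of k]] assms
  have "((\<lambda>r. - exp (- (k * r)) / k) \<longlongrightarrow> 0) at_top" by simp
  then have "(\<integral>\<^sup>+ r\<in>{0..}. ennreal (exp (- (k * r))) \<partial>lborel) = ennreal (0 - (- exp (- (k * 0)) / k))"
    using assms by (intro nn_integral_FTC_atLeast) (auto intro!: derivative_eq_intros)
  then show ?thesis by simp
qed

text \<open>For k > 0, 1 / k is the integral of exp (- k r) over r \<ge> 0; with k = c + d s this is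
  a mixture of exponentials in s with rates d r.\<close>

lemma cm_resolvent:
  fixes c d :: real
  assumes c: "0 < c" and d: "0 \<le> d"
  shows "cm (\<lambda>s. ennreal (1 / (c + d * s)))"
proof (rule cmI[where M=lborel and c="\<lambda>r. ennreal (exp (- (c * r))) * indicator {0..} r" and a="\<lambda>r. d * max 0 r"])
  show "(\<integral>\<^sup>+ r\<in>{0..}. ennreal (exp (- (c * r))) \<partial>lborel) < \<infinity>"
    using nn_integral_exp_atLeast_0[OF c] by simp
  show "ennreal (1 / (c + d * s)) =
      (\<integral>\<^sup>+ r. ennreal (exp (- (c * r))) * indicator {0..} r * ennreal (exp (- (d * max 0 r) * s)) \<partial>lborel)"
    if s: "0 \<le> s" for s
  proof -
    have "0 < c + d * s" using c d s by (simp add: add_pos_nonneg)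
    from nn_integral_exp_atLeast_0[OF this, symmetric] show ?thesis
      by (simp only:) (intro nn_integral_cong, auto simp: indicator_def ennreal_mult[symmetric] exp_add[symmetric] algebra_simps)
  qed
qed (use d in auto)

section \<open>The function \<open>cosh (p b)\<close> of \<open>cosh b\<close>\<close>

text \<open>Write \<open>J b\<close> for the integral of \<open>exp (p x) / (1 + exp (x - b))\<close>. Translation gives
  \<open>J b = exp (p b) * J 0\<close>, so \<open>2 cosh (p b) J 0 = J b + J (- b)\<close>. Combining the two fractions
  and symmetrising under \<open>x \<mapsto> - x\<close> exhibits \<open>(2 cosh (p b) - 2) J 0\<close> as the integral of
  \<open>deficit b\<close>: a positive constant minus a mixture of resolvents in \<open>cosh b\<close>, once the domain is
  truncated.\<close>

context
  fixes p :: real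
  assumes p: "0 < p" "p < 1"
begin

text \<open>The integrand is at most exp (p x), which handles the negative axis, and at most exp (-
  (1 - p) x), which handles the positive one. Both decay exactly because 0 < p < 1, so p = 1 is
  treated separately.\<close>

lemma integrable_logistic: "integrable lborel (\<lambda>x. exp (p * x) / (1 + exp x))"
proof (rule integrableI_bounded)
  let ?g = "\<lambda>k r. ennreal (exp (- (k * r))) * indicator {0..} r"
  have "(\<integral>\<^sup>+ x. ennreal (norm (exp (p * x) / (1 + exp x))) \<partial>lborel)
      \<le> (\<integral>\<^sup>+ x. ?g (1 - p) x + ?g p (0 + (-1) * x) \<partial>lborel)"
  proof (intro nn_integral_mono)
    fix x :: real
    have *: "exp (p * x) / (1 + exp x) \<le> exp (p * x)"
      by (simp add: divide_le_eq add_pos_pos mult_le_cancel_left1)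
    have "exp (p * x) / (1 + exp x) \<le> exp (p * x) / exp x"
      by (intro divide_left_mono) (auto simp: add_pos_pos)
    also have "\<dots> = exp (- ((1 - p) * x))"
      by (simp add: exp_diff[symmetric] algebra_simps)
    finally have **: "exp (p * x) / (1 + exp x) \<le> exp (- ((1 - p) * x))" .
    show "ennreal (norm (exp (p * x) / (1 + exp x))) \<le> ?g (1 - p) x + ?g p (0 + (-1) * x)"
    proof (cases "x < 0")
      case True
      then show ?thesis using * by (simp add: add_pos_pos abs_of_pos ennreal_leI)
    next
      case False
      then have "?g (1 - p) x = ennreal (exp (- ((1 - p) * x)))" by simp
      moreover have "ennreal (norm (exp (p * x) / (1 + exp x))) \<le> ennreal (exp (- ((1 - p) * x)))"
        using ** by (intro ennreal_leI) (simp add: add_pos_pos abs_of_pos)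
      ultimately show ?thesis by (metis add_increasing2 zero_le)
    qed
  qed
  also have "\<dots> = (\<integral>\<^sup>+ x. ?g (1 - p) x \<partial>lborel) + (\<integral>\<^sup>+ x. ?g p (0 + (-1) * x) \<partial>lborel)"
    by (rule nn_integral_add) measurable
  also have "(\<integral>\<^sup>+ x. ?g p (0 + (-1) * x) \<partial>lborel) = (\<integral>\<^sup>+ x. ?g p x \<partial>lborel)"
    using nn_integral_real_affine[of "?g p" "-1" 0] by simp
  finally show "(\<integral>\<^sup>+ x. ennreal (norm (exp (p * x) / (1 + exp x))) \<partial>lborel) < \<infinity>"
    using nn_integral_exp_atLeast_0[of p] nn_integral_exp_atLeast_0[of "1 - p"] p
    by (auto simp: less_top[symmetric] top_unique)
qed measurable

text \<open>The value is pi / sin (pi p); it enters as a positive normalising constant.\<close>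

definition logistic_integral :: real where "logistic_integral = (\<integral>x. exp (p * x) / (1 + exp x) \<partial>lborel)"

lemma logistic_integral_pos: "0 < logistic_integral"
proof -
  have "logistic_integral \<noteq> 0"
  proof
    assume "logistic_integral = 0"
    then have "AE x in lborel. exp (p * x) / (1 + exp x) = 0"
      unfolding logistic_integral_def using integrable_logistic
      by (subst (asm) integral_nonneg_eq_0_iff_AE) (auto simp: add_nonneg_nonneg)
    moreover have "1 + exp x \<noteq> 0" for x :: real using exp_gt_zero[of x] by linarith
    ultimately have "AE x in lborel :: real measure. False"
      by (auto elim!: eventually_mono)
    then show False by (simp add: ae_filter_eq_bot_iff)
  qed
  moreover have "0 \<le> logistic_integral" unfolding logistic_integral_def by (intro integral_nonneg_AE AE_I2) (auto simp: add_nonneg_nonneg)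
  ultimately show ?thesis by simp
qed

lemma shifted_logistic:
  "integrable lborel (\<lambda>x. exp (p * x) / (1 + exp (x - b)))"
  "(\<integral>x. exp (p * x) / (1 + exp (x - b)) \<partial>lborel) = exp (p * b) * logistic_integral"
proof -
  have eq: "exp (p * (b + 1 * x)) / (1 + exp ((b + 1 * x) - b)) = exp (p * b) * (exp (p * x) / (1 + exp x))"
    for x by (simp add: distrib_left exp_add)
  show "integrable lborel (\<lambda>x. exp (p * x) / (1 + exp (x - b)))"
    using lborel_integrable_real_affine_iff[of 1 "\<lambda>x. exp (p * x) / (1 + exp (x - b))" b]
      integrable_mult_right[OF integrable_logistic, of "exp (p * b)"]
    unfolding eq by simp
  show "(\<integral>x. exp (p * x) / (1 + exp (x - b)) \<partial>lborel) = exp (p * b) * logistic_integral"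
    using lborel_integral_real_affine[of 1 "\<lambda>x. exp (p * x) / (1 + exp (x - b))" b]
    unfolding eq logistic_integral_def by (simp del: times_divide_eq_right)
qed

definition logistic_pair :: "real \<Rightarrow> real \<Rightarrow> real" where
  "logistic_pair b x = exp (p * x) / (1 + exp (x - b)) + exp (p * x) / (1 + exp (x - (- b)))"

lemma logistic_pair_eq:
  "logistic_pair b x = exp (p * x) * (1 - sinh x / (cosh x + cosh b))"
proof -
  \<comment> \<open>In these variables the common denominator (u + v) (1 + u v) equals 2 u v (cosh x
    + cosh b), so b survives only through cosh b.\<close>
  define u v where "u = exp x" and "v = exp b"
  have uv: "0 < u" "0 < v" by (auto simp: u_def v_def)
  have "1 / (1 + u / v) = v / (u + v)"
    using uv by (simp add: field_simps)
  moreover have nz: "u + v \<noteq> 0" "1 + u * v \<noteq> 0"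
    using uv mult_pos_pos[of u v] by linarith+
  ultimately have "1 / (1 + u / v) + 1 / (1 + u * v) = (v * (1 + u * v) + (u + v)) / ((u + v) * (1 + u * v))"
    using nz by (simp add: add_frac_eq)
  also have "\<dots> = 1 - (u\<^sup>2 - 1) * v / ((u + v) * (1 + u * v))"
  proof -
    have "0 < (u + v) * (1 + u * v)" using uv by (simp add: add_pos_pos)
    moreover have "v * (1 + u * v) + (u + v) = (u + v) * (1 + u * v) - (u\<^sup>2 - 1) * v"
      by (simp add: algebra_simps power2_eq_square)
    ultimately show ?thesis using nz by (simp add: diff_divide_distrib)
  qed
  also have "(u\<^sup>2 - 1) * v / ((u + v) * (1 + u * v)) = sinh x / (cosh x + cosh b)"
  proof -
    have "sinh x = (u\<^sup>2 - 1) * v / (2 * u * v)"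
      using uv by (simp add: sinh_field_def exp_minus u_def[symmetric] field_simps power2_eq_square)
    moreover have "cosh x + cosh b = ((u + v) * (1 + u * v)) / (2 * u * v)"
      using uv by (simp add: cosh_field_def exp_minus u_def[symmetric] v_def[symmetric] field_simps power2_eq_square)
    ultimately show ?thesis using uv by simp
  qed
  finally have "1 / (1 + u / v) + 1 / (1 + u * v) = 1 - sinh x / (cosh x + cosh b)" .
  moreover have "exp (x - b) = u / v" "exp (x - (- b)) = u * v"
    by (simp_all add: u_def v_def exp_diff exp_add)
  ultimately have "exp (p * x) * (1 / (1 + exp (x - b)) + 1 / (1 + exp (x - (- b))))
      = exp (p * x) * (1 - sinh x / (cosh x + cosh b))" by simp
  then show ?thesis
    unfolding logistic_pair_def by (simp add: distrib_left)
qed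

text \<open>Half of \<open>logistic_pair b - logistic_pair 0\<close>, summed over x and - x: the
  terms without denominator cancel, and the odd part of exp (p x) remains. The difference of the two
  fractions is what makes it integrable; it leaves decay of order exp (- (1 - p) |x|).\<close>

definition deficit :: "real \<Rightarrow> real \<Rightarrow> real" where
  "deficit b x = sinh (p * x) * sinh x * (1 / (cosh x + 1) - 1 / (cosh x + cosh b))"

lemma sinh_mult_nonneg: "0 \<le> sinh (p * x) * sinh x"
  using p linear[of 0 x] by (auto simp: zero_le_mult_iff mult_le_0_iff)

lemma deficit:
  "integrable lborel (deficit b)"
  "(\<integral>x. deficit b x \<partial>lborel) = logistic_integral * (2 * cosh (p * b) - 2)"
proof -
  have int: "integrable lborel (logistic_pair b)" for b
    unfolding logistic_pair_def[abs_def]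
    by (intro Bochner_Integration.integrable_add shifted_logistic)
  have val: "(\<integral>x. logistic_pair b x \<partial>lborel) = logistic_integral * (2 * cosh (p * b))" for b
    unfolding logistic_pair_def[abs_def]
    by (subst Bochner_Integration.integral_add)
      (use shifted_logistic[of b] shifted_logistic[of "-b"] in \<open>auto simp: cosh_field_def algebra_simps\<close>)
  have int': "integrable lborel (\<lambda>x. logistic_pair b (0 + (-1) * x))" for b
    using int by (subst lborel_integrable_real_affine_iff) auto
  have val': "(\<integral>x. logistic_pair b (0 + (-1) * x) \<partial>lborel) = logistic_integral * (2 * cosh (p * b))" for b
    using lborel_integral_real_affine[of "-1" "logistic_pair b" 0] val[of b] by simp
  have eq: "deficit b x = ((logistic_pair b x + logistic_pair b (0 + (-1) * x))
     - (logistic_pair 0 x + logistic_pair 0 (0 + (-1) * x))) / 2" for x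
    unfolding deficit_def logistic_pair_eq
    by (simp add: sinh_field_def[of "p * x"] algebra_simps diff_divide_distrib add_divide_distrib)
  show "integrable lborel (deficit b)"
    unfolding eq[abs_def] using int int' by simp
  show "(\<integral>x. deficit b x \<partial>lborel) = logistic_integral * (2 * cosh (p * b) - 2)"
    unfolding eq using int int' val val' by (simp add: field_simps)
qed

lemma deficit_nonneg: "0 \<le> deficit b x"
proof -
  have "1 / (cosh x + cosh b) \<le> 1 / (cosh x + 1)"
    using cosh_real_ge_1[of x] cosh_real_ge_1[of b] by (intro divide_left_mono) auto
  then show ?thesis
    unfolding deficit_def by (intro mult_nonneg_nonneg[OF sinh_mult_nonneg]) simp
qed

text \<open>Taken separately, each of the two terms of \<open>deficit\<close> grows like exp (p
  |x|), hence the cutoff. With s = 2 cosh b - 2 the denominator is cosh x + cosh b, which is affine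
  in s.\<close>

definition truncated :: "nat \<Rightarrow> real \<Rightarrow> real" where
  "truncated n s = (\<integral>x. indicator {- real n..real n} x * (sinh (p * x) * sinh x / (cosh x + 1 + s / 2)) \<partial>lborel)"

lemma integrable_truncated:
  assumes "0 \<le> s"
  shows "integrable lborel (\<lambda>x. indicator {- real n..real n} x * (sinh (p * x) * sinh x / (cosh x + 1 + s / 2)))"
proof -
  have "cosh x + 1 + s / 2 \<noteq> 0" for x :: real
    using cosh_real_ge_1[of x] assms by linarith
  then have "continuous_on {- real n..real n} (\<lambda>x. sinh (p * x) * sinh x / (cosh x + 1 + s / 2))"
    by (intro continuous_intros) auto
  from borel_integrable_atLeastAtMost'[OF this] show ?thesis
    by (simp add: set_integrable_def)
qed

lemma truncated_nonneg:
  assumes "0 \<le> s" shows "0 \<le> truncated n s"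
  unfolding truncated_def
proof (rule integral_nonneg_AE[OF AE_I2])
  show "0 \<le> indicator {- real n..real n} x * (sinh (p * x) * sinh x / (cosh x + 1 + s / 2))" for x
    using sinh_mult_nonneg[of x] assms by (auto simp: indicator_def intro!: divide_nonneg_nonneg)
qed

lemma cm_truncated: "cm (\<lambda>s. ennreal (truncated n s))"
proof -
  let ?w = "\<lambda>x. indicator {- real n..real n} x * (sinh (p * x) * sinh x)"
  have w: "0 \<le> ?w x" for x using sinh_mult_nonneg[of x] by (auto simp: indicator_def)
  have eq: "ennreal (truncated n s) = (\<integral>\<^sup>+ x. ennreal (?w x) * ennreal (1 / ((cosh x + 1) + 1 / 2 * s)) \<partial>lborel)"
    if s: "0 \<le> s" for s
  proof -
    have "ennreal (truncated n s) = (\<integral>\<^sup>+ x. ennreal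
       (indicator {- real n..real n} x * (sinh (p * x) * sinh x / (cosh x + 1 + s / 2))) \<partial>lborel)"
      unfolding truncated_def
    proof (rule nn_integral_eq_integral[symmetric, OF integrable_truncated[OF s] AE_I2])
      fix x
      show "0 \<le> indicator {- real n..real n} x * (sinh (p * x) * sinh x / (cosh x + 1 + s / 2))"
        using sinh_mult_nonneg[of x] s by (auto simp: indicator_def intro!: divide_nonneg_nonneg)
    qed
    also have "\<dots> = (\<integral>\<^sup>+ x. ennreal (?w x) * ennreal (1 / ((cosh x + 1) + 1 / 2 * s)) \<partial>lborel)"
    proof (rule nn_integral_cong)
      fix x
      have "0 \<le> 1 / ((cosh x + 1) + 1 / 2 * s)" using s cosh_real_ge_1[of x] by simp
      from ennreal_mult[OF w this]
      show "ennreal (indicator {- real n..real n} x * (sinh (p * x) * sinh x / (cosh x + 1 + s / 2)))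
          = ennreal (?w x) * ennreal (1 / ((cosh x + 1) + 1 / 2 * s))" by simp
    qed
    finally show ?thesis .
  qed
  show ?thesis
  proof (rule cm_mixture[OF _ _ _ eq])
    show "AE x in lborel. cm (\<lambda>s. ennreal (?w x) * ennreal (1 / ((cosh x + 1) + 1 / 2 * s)))"
    proof (rule AE_I2)
      fix x :: real
      have "0 < cosh x + 1" using cosh_real_ge_1[of x] by linarith
      then show "cm (\<lambda>s. ennreal (?w x) * ennreal (1 / ((cosh x + 1) + 1 / 2 * s)))"
        by (intro cm_cmult cm_resolvent) simp_all
    qed
    show "(\<integral>\<^sup>+ x. ennreal (?w x) * ennreal (1 / ((cosh x + 1) + 1 / 2 * 0)) \<partial>lborel) < \<infinity>"
      by (simp only: eq[OF order_refl, symmetric] ennreal_less_top infinity_ennreal_def)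
    have [measurable]: "(sinh :: real \<Rightarrow> real) \<in> borel_measurable borel"
        "(cosh :: real \<Rightarrow> real) \<in> borel_measurable borel"
      by (auto intro!: borel_measurable_continuous_onI
          continuous_on_sinh[OF continuous_on_id] continuous_on_cosh[OF continuous_on_id])
    show "(\<lambda>x. ennreal (?w x) * ennreal (1 / ((cosh x + 1) + 1 / 2 * s))) \<in> borel_measurable lborel" for s
      by measurable
  qed
qed

lemma truncated_tendsto:
  "(\<lambda>n. truncated n 0 - truncated n (2 * cosh b - 2)) \<longlonglongrightarrow> logistic_integral * (2 * cosh (p * b) - 2)"
proof -
  have "truncated n 0 - truncated n (2 * cosh b - 2)
     = (\<integral>x. indicator {- real n..real n} x * deficit b x \<partial>lborel)" for n
  proof -
    have "0 \<le> 2 * cosh b - 2" using cosh_real_ge_1[of b] by simp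
    note diff = Bochner_Integration.integral_diff[OF integrable_truncated[OF order_refl] integrable_truncated[OF this]]
    show ?thesis
      unfolding truncated_def diff[symmetric]
      by (intro Bochner_Integration.integral_cong)
        (simp_all add: deficit_def right_diff_distrib diff_divide_distrib)
  qed
  moreover have "(\<lambda>n. \<integral>x. indicator {- real n..real n} x * deficit b x \<partial>lborel)
      \<longlonglongrightarrow> (\<integral>x. deficit b x \<partial>lborel)"
  proof (rule integral_dominated_convergence[where w="deficit b"])
    have "(\<lambda>n. indicator {- real n..real n} x * deficit b x) \<longlonglongrightarrow> deficit b x" for x
    proof (rule tendsto_eventually)
      obtain N where "\<bar>x\<bar> \<le> real N" using real_arch_simple by blast
      then have "indicator {- real n..real n} x * deficit b x = deficit b x" if "N \<le> n" for n
        using that by (auto simp: indicator_def)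
      then show "eventually (\<lambda>n. indicator {- real n..real n} x * deficit b x = deficit b x) sequentially"
        unfolding eventually_sequentially by blast
    qed
    then show "AE x in lborel. (\<lambda>n. indicator {- real n..real n} x * deficit b x) \<longlonglongrightarrow> deficit b x"
      by simp
    show "AE x in lborel. norm (indicator {- real n..real n} x * deficit b x) \<le> deficit b x" for n
      using deficit_nonneg by (auto simp: indicator_def)
  qed (use deficit(1) in \<open>auto\<close>)
  ultimately show ?thesis by (simp add: deficit(2))
qed

text \<open>The exponent is the limit of - t / \<open>logistic_integral\<close> times
  \<open>truncated n 0 - truncated n s\<close>. For fixed n the term \<open>truncated n 0\<close>
  contributes only a constant factor, which normalises the value at s = 0 to 1, and the rest is the
  exponential of a completely monotone function. The sign of the second term is what makes
  \<open>cm_exp\<close> applicable.\<close>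

lemma cm_exp_cosh_lt_1:
  assumes t: "0 \<le> t"
  shows "cm (\<lambda>s. ennreal (exp (- t * (2 * cosh (p * arcosh (1 + s / 2)) - 2))))"
proof (rule cm_limit)
  define \<phi> where "\<phi> n s = exp (- (t / logistic_integral * truncated n 0)) * exp (t / logistic_integral * truncated n s)" for n s
  have "cm (\<lambda>s. ennreal (t / logistic_integral) * ennreal (truncated n s))" for n
    by (intro cm_cmult cm_truncated) simp
  moreover have "cm (\<lambda>s. ennreal (t / logistic_integral) * ennreal (truncated n s)) \<longleftrightarrow>
      cm (\<lambda>s. ennreal (t / logistic_integral * truncated n s))" for n
    using t logistic_integral_pos by (intro cm_cong) (simp add: ennreal_mult[symmetric] truncated_nonneg)
  ultimately have "cm (\<lambda>s. ennreal (t / logistic_integral * truncated n s))" for n by simp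
  then have "cm (\<lambda>s. ennreal (exp (t / logistic_integral * truncated n s)))" for n
    using t logistic_integral_pos truncated_nonneg by (intro cm_exp) auto
  then have "cm (\<lambda>s. ennreal (exp (- (t / logistic_integral * truncated n 0))) * ennreal (exp (t / logistic_integral * truncated n s)))" for n
    by (intro cm_cmult) simp_all
  then show "cm (\<lambda>s. ennreal (\<phi> n s))" for n
    unfolding \<phi>_def by (simp add: ennreal_mult)
  show "\<phi> n 0 = 1" for n
    unfolding \<phi>_def by (simp add: exp_add[symmetric])
  show "0 \<le> \<phi> n s" for n s unfolding \<phi>_def by simp
  show "(\<lambda>n. \<phi> n s) \<longlonglongrightarrow> exp (- t * (2 * cosh (p * arcosh (1 + s / 2)) - 2))" if s: "0 \<le> s" for s
  proof -
    define b where "b = arcosh (1 + s / 2)"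
    have sb: "s = 2 * cosh b - 2" unfolding b_def using s by simp
    have "\<phi> n s = exp (- (t / logistic_integral * (truncated n 0 - truncated n (2 * cosh b - 2))))" for n
      unfolding \<phi>_def sb[symmetric] by (simp add: exp_add[symmetric] algebra_simps)
    moreover have "(\<lambda>n. exp (- (t / logistic_integral * (truncated n 0 - truncated n (2 * cosh b - 2)))))
      \<longlonglongrightarrow> exp (- (t / logistic_integral * (logistic_integral * (2 * cosh (p * b) - 2))))"
      by (intro tendsto_intros truncated_tendsto)
    ultimately show ?thesis
      using logistic_integral_pos by (simp add: b_def[symmetric])
  qed
  have "continuous_on {0..} (\<lambda>s. exp (- t * (2 * cosh (p * arcosh (1 + s / 2)) - 2)))"
    by (intro continuous_intros) auto
  then have "((\<lambda>s. exp (- t * (2 * cosh (p * arcosh (1 + s / 2)) - 2))) \<longlongrightarrow>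
     exp (- t * (2 * cosh (p * arcosh (1 + 0 / 2)) - 2))) (at 0 within {0..})"
    unfolding continuous_on_def by (rule bspec) simp
  then have "((\<lambda>s. exp (- t * (2 * cosh (p * arcosh (1 + s / 2)) - 2))) \<longlongrightarrow> 1) (at 0 within {0..})"
    by simp
  moreover have "filterlim (\<lambda>m. 1 / real (Suc m)) (at 0 within {0..}) sequentially"
    using LIMSEQ_inverse_real_of_nat by (auto simp: filterlim_at inverse_eq_divide)
  ultimately show "(\<lambda>m. exp (- t * (2 * cosh (p * arcosh (1 + 1 / real (Suc m) / 2)) - 2))) \<longlonglongrightarrow> 1"
    by (rule filterlim_compose)
qed

end

lemma cm_exp_cosh:
  assumes "0 < p" "p \<le> 1" "0 \<le> t"
  shows "cm (\<lambda>s. ennreal (exp (- t * (2 * cosh (p * arcosh (1 + s / 2)) - 2))))"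
proof (cases "p = 1")
  case True
  show ?thesis
    by (rule cmI[where M="count_space {()}" and c="\<lambda>_. 1" and a="\<lambda>_. t"])
      (use assms True in \<open>auto simp: nn_integral_count_space_finite\<close>)
next
  case False
  then show ?thesis using assms by (intro cm_exp_cosh_lt_1) auto
qed

section \<open>Hyperbolic complete monotonicity in logarithmic coordinates\<close>

text \<open>If \<open>v = exp b\<close> then \<open>v + 1 / v = ch b + 2\<close>. Because \<open>ch 0 = 0\<close>, the measures representing the
  products below are finite: their mass is the square of the value at the centre.\<close>

definition ch :: "real \<Rightarrow> real" where "ch b = 2 * cosh b - 2"

lemma ch_nonneg: "0 \<le> ch b"
  using cosh_real_ge_1[of b] by (simp add: ch_def)

lemma ch_0 [simp]: "ch 0 = 0" and ch_minus [simp]: "ch (- b) = ch b"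
  by (simp_all add: ch_def)

lemma ch_minus_commute: "ch (a - b) = ch (b - a)"
  using ch_minus[of "b - a"] by simp

lemma ch_mono: "\<bar>a\<bar> \<le> \<bar>b\<bar> \<Longrightarrow> ch a \<le> ch b"
  by (metis abs_ge_zero ch_def cosh_real_abs cosh_real_nonneg_le_iff diff_right_mono mult_left_mono zero_le_numeral)

lemma ch_exp: "exp b + exp (- b) = ch b + 2"
  by (simp add: ch_def cosh_field_def)

lemma ch_arcosh: "0 \<le> s \<Longrightarrow> ch (arcosh (1 + s / 2)) = s"
  by (simp add: ch_def)

lemma arcosh_ch: "arcosh (1 + ch b / 2) = \<bar>b\<bar>"
proof -
  have "1 + ch b / 2 = cosh \<bar>b\<bar>" by (simp add: ch_def diff_divide_distrib)
  then show ?thesis by (simp only: arcosh_cosh_real abs_ge_zero)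
qed

lemma measurable_ch [measurable]: "ch \<in> borel_measurable borel"
proof -
  have "continuous_on UNIV ch" unfolding ch_def[abs_def] by (intro continuous_intros)
  then show ?thesis by (rule borel_measurable_continuous_onI)
qed

text \<open>\<open>ucm\<close> and \<open>bcm\<close> are HCM and BVHCM for the functions \<open>s \<mapsto> h (exp s)\<close> and
  \<open>(s, t) \<mapsto> f (exp s, exp t)\<close>.\<close>

definition ucm :: "(real \<Rightarrow> ennreal) \<Rightarrow> bool" where
  "ucm g \<longleftrightarrow> (\<forall>a. g a < \<infinity> \<and> (\<exists>\<phi>. cm \<phi> \<and> (\<forall>b. g (a + b) * g (a - b) = \<phi> (ch b))))"

definition bcm_at :: "(real \<Rightarrow> real \<Rightarrow> ennreal) \<Rightarrow> real \<Rightarrow> real \<Rightarrow> bool" where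
  "bcm_at F a1 a2 \<longleftrightarrow> (\<exists>P. sets P = sets (borel \<Otimes>\<^sub>M (borel \<Otimes>\<^sub>M borel)) \<and>
     (AE (l1, l2, l3) in P. 0 \<le> l1 \<and> 0 \<le> l2 \<and> 0 \<le> l3) \<and>
     (\<forall>b1 b2. F (a1 + b1) (a2 + b2) * F (a1 - b1) (a2 - b2) =
        (\<integral>\<^sup>+ (l1, l2, l3). ennreal (exp (- (l1 * ch b1 + l2 * ch b2 + l3 * ch (b1 - b2)))) \<partial>P)))"

definition bcm :: "(real \<Rightarrow> real \<Rightarrow> ennreal) \<Rightarrow> bool" where
  "bcm F \<longleftrightarrow> (\<forall>a1 a2. F a1 a2 < \<infinity> \<and> bcm_at F a1 a2)"

lemma bcm_atI:
  assumes [measurable]: "c \<in> borel_measurable M" "x1 \<in> borel_measurable M"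
      "x2 \<in> borel_measurable M" "x3 \<in> borel_measurable M"
    and ae: "AE x in M. 0 \<le> x1 x \<and> 0 \<le> x2 x \<and> 0 \<le> x3 x"
    and eq: "\<And>b1 b2. F (a1 + b1) (a2 + b2) * F (a1 - b1) (a2 - b2) =
        (\<integral>\<^sup>+ x. c x * ennreal (exp (- (x1 x * ch b1 + x2 x * ch b2 + x3 x * ch (b1 - b2)))) \<partial>M)"
  shows "bcm_at F a1 a2"
  unfolding bcm_at_def
proof (intro exI conjI allI)
  let ?P = "distr (density M c) (borel \<Otimes>\<^sub>M (borel \<Otimes>\<^sub>M borel)) (\<lambda>x. (x1 x, x2 x, x3 x))"
  show "sets ?P = sets (borel \<Otimes>\<^sub>M (borel \<Otimes>\<^sub>M borel))" by simp
  show "AE (l1, l2, l3) in ?P. 0 \<le> l1 \<and> 0 \<le> l2 \<and> 0 \<le> l3"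
    using ae by (subst AE_distr_iff) (auto simp: AE_density)
  show "F (a1 + b1) (a2 + b2) * F (a1 - b1) (a2 - b2) =
      (\<integral>\<^sup>+ (l1, l2, l3). ennreal (exp (- (l1 * ch b1 + l2 * ch b2 + l3 * ch (b1 - b2)))) \<partial>?P)" for b1 b2
    unfolding eq by (subst nn_integral_distr) (auto simp: nn_integral_density)
qed

lemma bcm_atE:
  assumes "bcm F"
  obtains P where "sets P = sets (borel \<Otimes>\<^sub>M (borel \<Otimes>\<^sub>M borel))" "finite_measure P"
    "AE l in P. 0 \<le> fst l \<and> 0 \<le> fst (snd l) \<and> 0 \<le> snd (snd l)"
    "\<And>b1 b2. F (a1 + b1) (a2 + b2) * F (a1 - b1) (a2 - b2) =
        (\<integral>\<^sup>+ l. ennreal (exp (- (fst l * ch b1 + fst (snd l) * ch b2 + snd (snd l) * ch (b1 - b2)))) \<partial>P)"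
proof -
  from assms obtain P where P: "sets P = sets (borel \<Otimes>\<^sub>M (borel \<Otimes>\<^sub>M borel))"
    "AE l in P. 0 \<le> fst l \<and> 0 \<le> fst (snd l) \<and> 0 \<le> snd (snd l)"
    "\<And>b1 b2. F (a1 + b1) (a2 + b2) * F (a1 - b1) (a2 - b2) =
        (\<integral>\<^sup>+ l. ennreal (exp (- (fst l * ch b1 + fst (snd l) * ch b2 + snd (snd l) * ch (b1 - b2)))) \<partial>P)"
    unfolding bcm_def bcm_at_def case_prod_beta by blast
  have "F a1 a2 < \<infinity>" using assms unfolding bcm_def by blast
  then have "emeasure P (space P) < \<infinity>"
    using P(3)[of 0 0] ennreal_mult_less_top[of "F a1 a2" "F a1 a2"] by simp
  then have "finite_measure P" by (intro finite_measureI) simp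
  with P that show ?thesis by blast
qed

section \<open>Closure under weights, permutations of the arguments and scaling\<close>

lemma bcm_finite: "bcm F \<Longrightarrow> F s t < \<infinity>"
  unfolding bcm_def by blast

text \<open>The product of the weights at a + b and a - b does not depend on b, so the representing
  measure is only multiplied by a constant. In the original coordinates the weight is a monomial k
  x^\<alpha> y^\<beta>, the form taken by all Jacobians below.\<close>

lemma bcm_weight:
  assumes F: "bcm F" and k: "0 \<le> k"
  shows "bcm (\<lambda>s t. ennreal (k * exp (\<alpha> * s + \<beta> * t)) * F s t)"
  unfolding bcm_def
proof (intro allI conjI)
  fix a1 a2
  show "ennreal (k * exp (\<alpha> * a1 + \<beta> * a2)) * F a1 a2 < \<infinity>"
    using bcm_finite[OF F, of a1 a2] by (simp add: ennreal_mult_less_top)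
  obtain P where P: "sets P = sets (borel \<Otimes>\<^sub>M (borel \<Otimes>\<^sub>M borel))" "finite_measure P"
    "AE l in P. 0 \<le> fst l \<and> 0 \<le> fst (snd l) \<and> 0 \<le> snd (snd l)"
    "\<And>b1 b2. F (a1 + b1) (a2 + b2) * F (a1 - b1) (a2 - b2) =
        (\<integral>\<^sup>+ l. ennreal (exp (- (fst l * ch b1 + fst (snd l) * ch b2 + snd (snd l) * ch (b1 - b2)))) \<partial>P)"
    by (rule bcm_atE[OF F, of a1 a2]) blast
  note [measurable_cong] = P(1)
  define K where "K = k\<^sup>2 * exp (2 * (\<alpha> * a1 + \<beta> * a2))"
  show "bcm_at (\<lambda>s t. ennreal (k * exp (\<alpha> * s + \<beta> * t)) * F s t) a1 a2"
  proof (rule bcm_atI[where M=P and c="\<lambda>_. ennreal K" and ?x1.0=fst and ?x2.0="\<lambda>l. fst (snd l)" and ?x3.0="\<lambda>l. snd (snd l)"])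
    fix b1 b2
    have "ennreal (k * exp (\<alpha> * (a1 + b1) + \<beta> * (a2 + b2))) * ennreal (k * exp (\<alpha> * (a1 - b1) + \<beta> * (a2 - b2))) = ennreal K"
    proof -
      have "2 * (\<alpha> * a1 + \<beta> * a2) = (\<alpha> * (a1 + b1) + \<beta> * (a2 + b2)) + (\<alpha> * (a1 - b1) + \<beta> * (a2 - b2))"
        by (simp add: algebra_simps)
      then have "K = (k * exp (\<alpha> * (a1 + b1) + \<beta> * (a2 + b2))) * (k * exp (\<alpha> * (a1 - b1) + \<beta> * (a2 - b2)))"
        unfolding K_def power2_eq_square by (simp only: exp_add mult_ac)
      then show ?thesis using k by (simp add: ennreal_mult)
    qed
    then have "ennreal (k * exp (\<alpha> * (a1 + b1) + \<beta> * (a2 + b2))) * F (a1 + b1) (a2 + b2) *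
        (ennreal (k * exp (\<alpha> * (a1 - b1) + \<beta> * (a2 - b2))) * F (a1 - b1) (a2 - b2)) =
        ennreal K * (F (a1 + b1) (a2 + b2) * F (a1 - b1) (a2 - b2))"
      by (simp only: mult_ac flip: \<open>_ = ennreal K\<close>)
    also have "\<dots> = (\<integral>\<^sup>+ l. ennreal K * ennreal (exp (- (fst l * ch b1 + fst (snd l) * ch b2 + snd (snd l) * ch (b1 - b2)))) \<partial>P)"
      unfolding P(4) by (rule nn_integral_cmult[symmetric]) measurable
    finally show "ennreal (k * exp (\<alpha> * (a1 + b1) + \<beta> * (a2 + b2))) * F (a1 + b1) (a2 + b2) *
        (ennreal (k * exp (\<alpha> * (a1 - b1) + \<beta> * (a2 - b2))) * F (a1 - b1) (a2 - b2)) = \<dots>" .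
  qed (use P(3) in \<open>auto\<close>)
qed

text \<open>Up to sign, b1, b2 and b1 - b2 are the pairwise differences of b1, b2 and 0. A linear
  substitution that permutes them, up to sign, merely permutes the coordinates of the representing
  measure; \<open>x1\<close>, \<open>x2\<close>, \<open>x3\<close> record how.\<close>

lemma bcm_permute:
  assumes F: "bcm F" and G: "\<And>s t. G s t = F (f s t) (g s t)"
    and lin: "\<And>s t s' t'. f (s + s') (t + t') = f s t + f s' t'" "\<And>s t s' t'. f (s - s') (t - t') = f s t - f s' t'"
      "\<And>s t s' t'. g (s + s') (t + t') = g s t + g s' t'" "\<And>s t s' t'. g (s - s') (t - t') = g s t - g s' t'"
    and perm: "(x1, x2, x3) \<in> {(fst, fst \<circ> snd, snd \<circ> snd), (fst \<circ> snd, fst, snd \<circ> snd), (snd \<circ> snd, fst \<circ> snd, fst)}"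
    and ch: "\<And>l :: real \<times> real \<times> real. \<And>s t. fst l * ch (f s t) + fst (snd l) * ch (g s t) + snd (snd l) * ch (f s t - g s t) =
       x1 l * ch s + x2 l * ch t + x3 l * ch (s - t)"
  shows "bcm G"
  unfolding bcm_def
proof (intro allI conjI)
  fix a1 a2
  show "G a1 a2 < \<infinity>" unfolding G by (rule bcm_finite[OF F])
  obtain P where P: "sets P = sets (borel \<Otimes>\<^sub>M (borel \<Otimes>\<^sub>M borel))" "finite_measure P"
    "AE l in P. 0 \<le> fst l \<and> 0 \<le> fst (snd l) \<and> 0 \<le> snd (snd l)"
    "\<And>b1 b2. F (f a1 a2 + b1) (g a1 a2 + b2) * F (f a1 a2 - b1) (g a1 a2 - b2) =
        (\<integral>\<^sup>+ l. ennreal (exp (- (fst l * ch b1 + fst (snd l) * ch b2 + snd (snd l) * ch (b1 - b2)))) \<partial>P)"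
    by (rule bcm_atE[OF F, of "f a1 a2" "g a1 a2"]) blast
  note [measurable_cong] = P(1)
  have [measurable]: "x1 \<in> borel_measurable P" "x2 \<in> borel_measurable P" "x3 \<in> borel_measurable P"
    using perm by (auto simp: o_def)
  show "bcm_at G a1 a2"
  proof (rule bcm_atI[where M=P and c="\<lambda>_. 1" and ?x1.0=x1 and ?x2.0=x2 and ?x3.0=x3])
    show "AE l in P. 0 \<le> x1 l \<and> 0 \<le> x2 l \<and> 0 \<le> x3 l"
      using P(3) by eventually_elim (use perm in auto)
    show "G (a1 + b1) (a2 + b2) * G (a1 - b1) (a2 - b2) =
       (\<integral>\<^sup>+ l. 1 * ennreal (exp (- (x1 l * ch b1 + x2 l * ch b2 + x3 l * ch (b1 - b2)))) \<partial>P)" for b1 b2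
      unfolding G lin P(4) ch by simp
  qed simp_all
qed

lemma bcm_swap: "bcm F \<Longrightarrow> bcm (\<lambda>s t. F t s)"
  by (rule bcm_permute[where f="\<lambda>s t. t" and g="\<lambda>s t. s" and ?x1.0="fst \<circ> snd" and ?x2.0=fst and ?x3.0="snd \<circ> snd"])
    (auto simp: algebra_simps ch_minus_commute)

lemma bcm_reflect: "bcm F \<Longrightarrow> bcm (\<lambda>s t. F (- s) (- t))"
  by (rule bcm_permute[where f="\<lambda>s t. - s" and g="\<lambda>s t. - t" and ?x1.0=fst and ?x2.0="fst \<circ> snd" and ?x3.0="snd \<circ> snd"])
    (auto simp: ch_minus_commute)

text \<open>In the original coordinates the substitution is (x, y) -> (x / y, 1 / y); it exchanges
  the roles of b1 and b1 - b2.\<close>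

lemma bcm_shear: "bcm F \<Longrightarrow> bcm (\<lambda>s t. F (s - t) (- t))"
  by (rule bcm_permute[where f="\<lambda>s t. s - t" and g="\<lambda>s t. - t" and ?x1.0="snd \<circ> snd" and ?x2.0="fst \<circ> snd" and ?x3.0=fst])
    auto

lemma nn_integral_pair_mult:
  assumes "sigma_finite_measure N" and [measurable]: "f \<in> borel_measurable M" "g \<in> borel_measurable N"
  shows "(\<integral>\<^sup>+ x. f (fst x) * g (snd x) \<partial>(M \<Otimes>\<^sub>M N)) = (\<integral>\<^sup>+ x. f x \<partial>M) * (\<integral>\<^sup>+ y. g y \<partial>N)"
  using assms(1)
  by (subst sigma_finite_measure.nn_integral_fst[symmetric])
    (auto simp: nn_integral_cmult nn_integral_multc)

lemma AE_pair_of_marginals: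
  assumes "pair_sigma_finite M N" and [measurable]: "Measurable.pred M p" "Measurable.pred N q"
    and "AE x in M. p x" "AE y in N. q y"
  shows "AE x in M \<Otimes>\<^sub>M N. p (fst x) \<and> q (snd x)"
  using assms(4,5)
  by (intro pair_sigma_finite.AE_pair_measure[OF assms(1)]) (auto elim!: eventually_mono)

text \<open>This is subordination in each coordinate independently: a rate l is replaced by a random
  rate with law \<open>\<kappa> l\<close>, whose transform at ch b is exp (- l ch (p b)). The third
  argument fits because p b1 - p b2 = p (b1 - b2).\<close>

lemma bcm_scale:
  assumes F: "bcm F" and p: "0 < p" "p \<le> 1"
  shows "bcm (\<lambda>s t. F (p * s) (p * t))"
  unfolding bcm_def
proof (intro allI conjI)
  fix a1 a2
  show "F (p * a1) (p * a2) < \<infinity>" by (rule bcm_finite[OF F])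
  obtain P where P: "sets P = sets (borel \<Otimes>\<^sub>M (borel \<Otimes>\<^sub>M borel))" "finite_measure P"
    "AE l in P. 0 \<le> fst l \<and> 0 \<le> fst (snd l) \<and> 0 \<le> snd (snd l)"
    "\<And>b1 b2. F (p * a1 + b1) (p * a2 + b2) * F (p * a1 - b1) (p * a2 - b2) =
        (\<integral>\<^sup>+ l. ennreal (exp (- (fst l * ch b1 + fst (snd l) * ch b2 + snd (snd l) * ch (b1 - b2)))) \<partial>P)"
    by (rule bcm_atE[OF F, of "p * a1" "p * a2"]) blast
  \<comment> \<open>The cutoff \<open>max 0 t\<close> makes this completely monotone for every real
    t, so that the kernel is defined on the whole line.\<close>
  define \<phi> where "\<phi> t s = ennreal (exp (- max 0 t * (2 * cosh (p * arcosh (1 + s / 2)) - 2)))" for t s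
  have cm_\<phi>: "cm (\<phi> t)" for t
    unfolding \<phi>_def[abs_def] using p by (intro cm_exp_cosh) auto
  have \<phi>_meas: "(\<lambda>t. \<phi> t s) \<in> borel_measurable borel" for s
    unfolding \<phi>_def by measurable
  have \<phi>_ch: "\<phi> t (ch b) = ennreal (exp (- (t * ch (p * b))))" if "0 \<le> t" for t b
  proof -
    have "cosh (p * \<bar>b\<bar>) = cosh (p * b)"
      using p cosh_real_abs[of "p * b"] by (simp add: abs_mult)
    then show ?thesis using that unfolding \<phi>_def arcosh_ch by (simp add: ch_def)
  qed
  obtain \<kappa> where \<kappa>0: "\<kappa> \<in> borel \<rightarrow>\<^sub>M subprob_algebra borel"
    "\<And>t. t \<in> space borel \<Longrightarrow> AE l in \<kappa> t. 0 \<le> l"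
    "\<And>t s. t \<in> space borel \<Longrightarrow> 0 \<le> s \<Longrightarrow> \<phi> t s = \<phi> t 0 * (\<integral>\<^sup>+ l. ennreal (exp (- l * s)) \<partial>\<kappa> t)"
    by (rule laplace_kernel[of borel \<phi>, OF cm_\<phi> \<phi>_meas]) blast
  have \<kappa>: "\<kappa> \<in> borel \<rightarrow>\<^sub>M subprob_algebra borel"
    "\<And>t. AE l in \<kappa> t. 0 \<le> l"
    "\<And>t s. 0 \<le> s \<Longrightarrow> \<phi> t s = \<phi> t 0 * (\<integral>\<^sup>+ l. ennreal (exp (- l * s)) \<partial>\<kappa> t)"
    by (rule \<kappa>0(1), rule \<kappa>0(2), simp, rule \<kappa>0(3), simp_all)
  \<comment> \<open>Here the masses \<open>\<phi> t 0\<close> are 1, so the normalised kernel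
    represents \<open>\<phi> t\<close> itself.\<close>
  have \<kappa>_ch: "(\<integral>\<^sup>+ l. ennreal (exp (- (l * ch b))) \<partial>\<kappa> t) = ennreal (exp (- (t * ch (p * b))))" if "0 \<le> t" for t b
    using \<kappa>(3)[OF ch_nonneg, of t b] \<phi>_ch[OF that, of b] by (simp add: \<phi>_def)
  have \<kappa>_sets [measurable_cong]: "sets (\<kappa> t) = sets borel" for t
    using subprob_measurableD(2)[OF \<kappa>(1)] by simp
  have \<kappa>_sub: "subprob_space (\<kappa> t)" for t
    using subprob_space_kernel[OF \<kappa>(1)] by simp
  have \<kappa>_sf: "sigma_finite_measure (\<kappa> t)" for t
    using \<kappa>_sub[of t] by (simp add: subprob_space_def finite_measure_def)
  define K where "K l = \<kappa> (fst l) \<Otimes>\<^sub>M (\<kappa> (fst (snd l)) \<Otimes>\<^sub>M \<kappa> (snd (snd l)))" for l :: "real \<times> real \<times> real"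
  note [measurable] = \<kappa>(1)
  note [measurable_cong] = P(1)
  have K [measurable]: "K \<in> P \<rightarrow>\<^sub>M subprob_algebra (borel \<Otimes>\<^sub>M (borel \<Otimes>\<^sub>M borel))"
    unfolding K_def
    by (intro measurable_pair_measure measurable_compose[OF _ \<kappa>(1)]) measurable
  have space_P: "space P \<noteq> {}"
    using sets_eq_imp_space_eq[OF P(1)] by (simp add: space_pair_measure)
  have sets_b [measurable_cong]: "sets (P \<bind> K) = sets (borel \<Otimes>\<^sub>M (borel \<Otimes>\<^sub>M borel))"
    using space_P subprob_measurableD(2)[OF K] by (intro sets_bind) auto
  have K_int: "(\<integral>\<^sup>+ r. ennreal (exp (- (fst r * ch b1 + fst (snd r) * ch b2 + snd (snd r) * ch b3))) \<partial>K l) =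
      ennreal (exp (- (fst l * ch (p * b1) + fst (snd l) * ch (p * b2) + snd (snd l) * ch (p * b3))))"
    if l: "0 \<le> fst l \<and> 0 \<le> fst (snd l) \<and> 0 \<le> snd (snd l)" for l b1 b2 b3
  proof -
    interpret ps: pair_subprob_space "\<kappa> (fst (snd l))" "\<kappa> (snd (snd l))"
      using \<kappa>_sub by (simp add: pair_subprob_space_def pair_sigma_finite_def \<kappa>_sf)
    have "(\<integral>\<^sup>+ r. ennreal (exp (- (fst r * ch b1 + fst (snd r) * ch b2 + snd (snd r) * ch b3))) \<partial>K l) =
      (\<integral>\<^sup>+ r. ennreal (exp (- (fst r * ch b1))) *
        (\<lambda>r. ennreal (exp (- (fst r * ch b2))) * ennreal (exp (- (snd r * ch b3)))) (snd r) \<partial>K l)"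
      by (intro nn_integral_cong) (simp add: ennreal_mult[symmetric] exp_add[symmetric])
    also have "\<dots> = (\<integral>\<^sup>+ r. ennreal (exp (- (r * ch b1))) \<partial>\<kappa> (fst l)) *
        ((\<integral>\<^sup>+ r. ennreal (exp (- (r * ch b2))) \<partial>\<kappa> (fst (snd l))) *
         (\<integral>\<^sup>+ r. ennreal (exp (- (r * ch b3))) \<partial>\<kappa> (snd (snd l))))"
      unfolding K_def
      by (subst nn_integral_pair_mult[OF ps.P.sigma_finite_measure_axioms], measurable)
        (subst nn_integral_pair_mult[OF \<kappa>_sf], measurable)
    also have "\<dots> = ennreal (exp (- (fst l * ch (p * b1) + fst (snd l) * ch (p * b2) + snd (snd l) * ch (p * b3))))"
      using l by (simp add: \<kappa>_ch ennreal_mult[symmetric] exp_add[symmetric])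
    finally show ?thesis .
  qed
  have K_AE: "AE r in K l. 0 \<le> fst r \<and> 0 \<le> fst (snd r) \<and> 0 \<le> snd (snd r)" for l
  proof -
    interpret ps: pair_subprob_space "\<kappa> (fst (snd l))" "\<kappa> (snd (snd l))"
      using \<kappa>_sub by (simp add: pair_subprob_space_def pair_sigma_finite_def \<kappa>_sf)
    have "AE r in \<kappa> (fst (snd l)) \<Otimes>\<^sub>M \<kappa> (snd (snd l)). 0 \<le> fst r \<and> 0 \<le> snd r"
      by (rule AE_pair_of_marginals) (simp_all add: ps.pair_sigma_finite_axioms \<kappa>(2))
    then show ?thesis
      unfolding K_def
      by (intro AE_pair_of_marginals[where q="\<lambda>r. 0 \<le> fst r \<and> 0 \<le> snd r"])
        (simp_all add: pair_sigma_finite_def \<kappa>_sf ps.P.sigma_finite_measure_axioms \<kappa>(2))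
  qed
  show "bcm_at (\<lambda>s t. F (p * s) (p * t)) a1 a2"
  proof (rule bcm_atI[where M="P \<bind> K" and c="\<lambda>_. 1" and ?x1.0=fst and ?x2.0="\<lambda>l. fst (snd l)" and ?x3.0="\<lambda>l. snd (snd l)"])
    show "AE r in P \<bind> K. 0 \<le> fst r \<and> 0 \<le> fst (snd r) \<and> 0 \<le> snd (snd r)"
      by (subst AE_bind[OF K]) (measurable, intro AE_I2 K_AE)
    fix b1 b2
    have "F (p * (a1 + b1)) (p * (a2 + b2)) * F (p * (a1 - b1)) (p * (a2 - b2)) =
      (\<integral>\<^sup>+ l. ennreal (exp (- (fst l * ch (p * b1) + fst (snd l) * ch (p * b2) + snd (snd l) * ch (p * (b1 - b2))))) \<partial>P)"
      using P(4)[of "p * b1" "p * b2"] by (simp add: algebra_simps)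
    also have "\<dots> = (\<integral>\<^sup>+ l. \<integral>\<^sup>+ r. ennreal (exp (- (fst r * ch b1 + fst (snd r) * ch b2 + snd (snd r) * ch (b1 - b2)))) \<partial>K l \<partial>P)"
      by (rule nn_integral_cong_AE, use P(3) in eventually_elim, rule K_int[symmetric])
    also have "\<dots> = (\<integral>\<^sup>+ r. ennreal (exp (- (fst r * ch b1 + fst (snd r) * ch b2 + snd (snd r) * ch (b1 - b2)))) \<partial>(P \<bind> K))"
      by (rule nn_integral_bind[symmetric, OF _ K]) measurable
    finally show "F (p * (a1 + b1)) (p * (a2 + b2)) * F (p * (a1 - b1)) (p * (a2 - b2)) =
      (\<integral>\<^sup>+ r. 1 * ennreal (exp (- (fst r * ch b1 + fst (snd r) * ch b2 + snd (snd r) * ch (b1 - b2)))) \<partial>(P \<bind> K))"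
      by simp
  qed measurable
qed

section \<open>Marginals\<close>

lemma nn_integral_shift:
  fixes c :: real
  assumes "g \<in> borel_measurable borel"
  shows "(\<integral>\<^sup>+ x. g (c + x) \<partial>lborel) = (\<integral>\<^sup>+ x. g x \<partial>lborel)"
  using nn_integral_real_affine[of g 1 c] assms by simp

lemma nn_integral_reflect:
  assumes "g \<in> borel_measurable borel"
  shows "(\<integral>\<^sup>+ x. g (- x) \<partial>lborel) = (\<integral>\<^sup>+ x. g (x :: real) \<partial>lborel)"
  using nn_integral_real_affine[of g "-1" 0] assms by simp

text \<open>The substitution y = r + q, z = r - q is split into two affine ones: y = 2 r - z for
  fixed z, which contributes the factor 2, and then z = r - q for fixed r.\<close>

lemma nn_integral_rotate:
  fixes G :: "real \<Rightarrow> real \<Rightarrow> ennreal"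
  assumes [measurable]: "(\<lambda>(y, z). G y z) \<in> borel_measurable (borel \<Otimes>\<^sub>M borel)"
  shows "(\<integral>\<^sup>+ y. \<integral>\<^sup>+ z. G y z \<partial>lborel \<partial>lborel) =
    (\<integral>\<^sup>+ r. \<integral>\<^sup>+ q. 2 * G (r + q) (r - q) \<partial>lborel \<partial>lborel)"
proof -
  have "(\<integral>\<^sup>+ y. \<integral>\<^sup>+ z. G y z \<partial>lborel \<partial>lborel) = (\<integral>\<^sup>+ z. \<integral>\<^sup>+ y. G y z \<partial>lborel \<partial>lborel)"
    by (rule lborel_pair.Fubini'[symmetric]) measurable
  also have "\<dots> = (\<integral>\<^sup>+ z. \<integral>\<^sup>+ r. 2 * G (2 * r - z) z \<partial>lborel \<partial>lborel)"
  proof (rule nn_integral_cong)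
    fix z
    have "(\<integral>\<^sup>+ y. G y z \<partial>lborel) = 2 * (\<integral>\<^sup>+ r. G (- z + 2 * r) z \<partial>lborel)"
      using nn_integral_real_affine[of "\<lambda>y. G y z" 2 "-z"] by simp
    also have "\<dots> = (\<integral>\<^sup>+ r. 2 * G (- z + 2 * r) z \<partial>lborel)"
      by (rule nn_integral_cmult[symmetric]) measurable
    finally show "(\<integral>\<^sup>+ y. G y z \<partial>lborel) = (\<integral>\<^sup>+ r. 2 * G (2 * r - z) z \<partial>lborel)"
      by (simp add: algebra_simps)
  qed
  also have "\<dots> = (\<integral>\<^sup>+ r. \<integral>\<^sup>+ z. 2 * G (2 * r - z) z \<partial>lborel \<partial>lborel)"
    by (rule lborel_pair.Fubini') measurable
  also have "\<dots> = (\<integral>\<^sup>+ r. \<integral>\<^sup>+ q. 2 * G (r + q) (r - q) \<partial>lborel \<partial>lborel)"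
  proof (rule nn_integral_cong)
    fix r
    have "(\<integral>\<^sup>+ z. 2 * G (2 * r - z) z \<partial>lborel) = (\<integral>\<^sup>+ q. 2 * G (2 * r - (r + (-1) * q)) (r + (-1) * q) \<partial>lborel)"
      using nn_integral_real_affine[of "\<lambda>z. 2 * G (2 * r - z) z" "-1" r] by simp
    then show "(\<integral>\<^sup>+ z. 2 * G (2 * r - z) z \<partial>lborel) = (\<integral>\<^sup>+ q. 2 * G (r + q) (r - q) \<partial>lborel)"
      by (simp add: algebra_simps)
  qed
  finally show ?thesis .
qed

text \<open>The substitution \<open>q = x - ln (l2 + l3 exp (- b))\<close> turns \<open>l2 * ch q + l3 * ch (b - q)\<close> into an
  expression affine in \<open>ch b\<close>. When \<open>l2 = l3 = 0\<close> it is not available and both integrals are infinite.\<close>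

definition bessel_rate :: "real \<Rightarrow> real \<Rightarrow> real \<Rightarrow> real" where
  "bessel_rate l2 l3 x = (if l2 + l3 = 0 then 0 else l2 * l3 * exp (- x))"

definition bessel_weight :: "real \<Rightarrow> real \<Rightarrow> real \<Rightarrow> real" where
  "bessel_weight l2 l3 x = (if l2 + l3 = 0 then 1
     else exp (2 * (l2 + l3) - exp x - exp (- x) * (l2 + l3)\<^sup>2))"

lemma bessel_integral:
  assumes l: "0 \<le> l2" "0 \<le> l3"
  shows "(\<integral>\<^sup>+ q. ennreal (exp (- (l2 * ch q + l3 * ch (b - q)))) \<partial>lborel) =
    (\<integral>\<^sup>+ x. ennreal (bessel_weight l2 l3 x) * ennreal (exp (- bessel_rate l2 l3 x * ch b)) \<partial>lborel)"
proof (cases "l2 + l3 = 0")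
  case True
  then have "l2 = 0" "l3 = 0" using l by auto
  then show ?thesis by (simp add: bessel_weight_def bessel_rate_def)
next
  case False
  define k where "k = l2 + l3 * exp (- b)"
  have k: "0 < k"
    using l False unfolding k_def by (cases "l2 = 0") (auto intro: add_pos_nonneg)
  have eq: "ennreal (exp (- (l2 * ch (- ln k + 1 * x) + l3 * ch (b - (- ln k + 1 * x))))) =
      ennreal (bessel_weight l2 l3 x) * ennreal (exp (- bessel_rate l2 l3 x * ch b))" for x
  proof -
    have e1: "ch (- ln k + 1 * x) = exp x / k + k * exp (- x) - 2"
      using ch_exp[of "- ln k + 1 * x"] k by (simp add: exp_diff exp_add exp_minus divide_inverse mult.commute)
    have e2: "ch (b - (- ln k + 1 * x)) = exp b * k * exp (- x) + exp (- b) * (exp x / k) - 2"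
    proof -
      have "exp (b - (- ln k + 1 * x)) = exp b * k * exp (- x)"
        "exp (- (b - (- ln k + 1 * x))) = exp (- b) * (exp x / k)"
        using k by (simp_all add: exp_diff exp_add exp_minus divide_inverse mult_ac)
      then show ?thesis using ch_exp[of "b - (- ln k + 1 * x)"] by (simp only: eq_diff_eq)
    qed
    have "l2 * ch (- ln k + 1 * x) + l3 * ch (b - (- ln k + 1 * x))
        = (l2 + l3 * exp (- b)) / k * exp x + exp (- x) * (k * (l2 + l3 * exp b)) - 2 * (l2 + l3)"
      unfolding e1 e2 using k by (simp add: field_simps)
    also have "(l2 + l3 * exp (- b)) / k = 1" using k by (simp add: k_def)
    \<comment> \<open>This product is the only place where b survives the translation, and it is
      symmetric under b -> - b; hence the dependence on ch b alone.\<close>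
    also have "k * (l2 + l3 * exp b) = (l2 + l3)\<^sup>2 + l2 * l3 * ch b"
    proof -
      have "exp (- b) * exp b = 1" by (simp add: exp_minus)
      then have "k * (l2 + l3 * exp b) = l2\<^sup>2 + l3\<^sup>2 + l2 * l3 * (exp b + exp (- b))"
        unfolding k_def power2_eq_square by algebra
      then show ?thesis unfolding ch_exp by (simp add: power2_eq_square algebra_simps)
    qed
    finally have "- (l2 * ch (- ln k + 1 * x) + l3 * ch (b - (- ln k + 1 * x))) =
        (2 * (l2 + l3) - exp x - exp (- x) * (l2 + l3)\<^sup>2) + (- (l2 * l3 * exp (- x)) * ch b)"
      by (simp add: algebra_simps)
    then show ?thesis
      using False by (simp add: bessel_weight_def bessel_rate_def ennreal_mult[symmetric] exp_add[symmetric])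
  qed
  show ?thesis
    using nn_integral_real_affine[of "\<lambda>q. ennreal (exp (- (l2 * ch q + l3 * ch (b - q))))" 1 "- ln k"]
    by (simp only: eq) simp
qed

text \<open>Integrating out \<open>q\<close> for a fixed \<open>r\<close> leaves a function of \<open>ch b\<close> alone. This must precede the
  integration over \<open>r\<close>: the three-dimensional representing measures are not unique, as their
  arguments lie on a surface, and need not depend measurably on \<open>r\<close>.\<close>

lemma section_product_cm:
  assumes F: "bcm F" and [measurable]: "(\<lambda>(s, t). F s t) \<in> borel_measurable (borel \<Otimes>\<^sub>M borel)"
  obtains \<phi> where "\<phi> 0 < \<infinity> \<Longrightarrow> cm \<phi>"
    "\<And>b. (\<integral>\<^sup>+ q. F (a + b) (r + q) * F (a - b) (r - q) \<partial>lborel) = \<phi> (ch b)"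
proof -
  obtain P where P: "sets P = sets (borel \<Otimes>\<^sub>M (borel \<Otimes>\<^sub>M borel))" "finite_measure P"
    "AE l in P. 0 \<le> fst l \<and> 0 \<le> fst (snd l) \<and> 0 \<le> snd (snd l)"
    "\<And>b1 b2. F (a + b1) (r + b2) * F (a - b1) (r - b2) =
        (\<integral>\<^sup>+ l. ennreal (exp (- (fst l * ch b1 + fst (snd l) * ch b2 + snd (snd l) * ch (b1 - b2)))) \<partial>P)"
    by (rule bcm_atE[OF F, of a r]) blast
  note [measurable_cong] = P(1)
  interpret P: finite_measure P by (rule P(2))
  interpret PL: pair_sigma_finite P lborel ..
  define w where "w y = (case y of (l, x) \<Rightarrow> ennreal (bessel_weight (fst (snd l)) (snd (snd l)) x))"
    for y :: "(real \<times> real \<times> real) \<times> real"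
  define \<rho> where "\<rho> y = (case y of (l, x) \<Rightarrow> max 0 (fst l + bessel_rate (fst (snd l)) (snd (snd l)) x))"
    for y :: "(real \<times> real \<times> real) \<times> real"
  have [measurable]: "w \<in> borel_measurable (P \<Otimes>\<^sub>M lborel)" "\<rho> \<in> borel_measurable (P \<Otimes>\<^sub>M lborel)"
    unfolding w_def \<rho>_def bessel_weight_def bessel_rate_def by measurable
  define \<phi> where "\<phi> s = (\<integral>\<^sup>+ y. w y * ennreal (exp (- \<rho> y * s)) \<partial>(P \<Otimes>\<^sub>M lborel))" for s
  \<comment> \<open>The mass \<open>\<phi> 0\<close> can be infinite, for instance if P charges the
    set l2 = l3 = 0; hence the condition.\<close>
  have "cm \<phi>" if "\<phi> 0 < \<infinity>"
    by (rule cmI[where c=w and a=\<rho> and M="P \<Otimes>\<^sub>M lborel"])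
      (use that in \<open>auto simp: \<phi>_def \<rho>_def split: prod.split\<close>)
  moreover have "(\<integral>\<^sup>+ q. F (a + b) (r + q) * F (a - b) (r - q) \<partial>lborel) = \<phi> (ch b)" for b
  proof -
    have "(\<integral>\<^sup>+ q. F (a + b) (r + q) * F (a - b) (r - q) \<partial>lborel) =
       (\<integral>\<^sup>+ l. \<integral>\<^sup>+ q. ennreal (exp (- (fst l * ch b + fst (snd l) * ch q + snd (snd l) * ch (b - q)))) \<partial>lborel \<partial>P)"
      unfolding P(4) by (rule PL.Fubini') measurable
    also have "\<dots> = (\<integral>\<^sup>+ l. \<integral>\<^sup>+ x. w (l, x) * ennreal (exp (- \<rho> (l, x) * ch b)) \<partial>lborel \<partial>P)"
    proof (rule nn_integral_cong_AE, use P(3) in eventually_elim)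
      fix l :: "real \<times> real \<times> real"
      obtain l1 l2 l3 where l_eq: "l = (l1, l2, l3)" by (cases l)
      assume "0 \<le> fst l \<and> 0 \<le> fst (snd l) \<and> 0 \<le> snd (snd l)"
      then have l: "0 \<le> l1" "0 \<le> l2" "0 \<le> l3" by (auto simp: l_eq)
      have "0 \<le> bessel_rate l2 l3 x" for x using l by (simp add: bessel_rate_def)
      then have \<rho>: "\<rho> (l, x) = l1 + bessel_rate l2 l3 x" for x
        using l by (simp add: \<rho>_def l_eq)
      have "(\<integral>\<^sup>+ q. ennreal (exp (- (l1 * ch b + l2 * ch q + l3 * ch (b - q)))) \<partial>lborel)
         = (\<integral>\<^sup>+ q. ennreal (exp (- (l1 * ch b))) * ennreal (exp (- (l2 * ch q + l3 * ch (b - q)))) \<partial>lborel)"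
        by (simp add: ennreal_mult[symmetric] exp_add[symmetric] algebra_simps)
      also have "\<dots> = ennreal (exp (- (l1 * ch b))) * (\<integral>\<^sup>+ q. ennreal (exp (- (l2 * ch q + l3 * ch (b - q)))) \<partial>lborel)"
        by (rule nn_integral_cmult) measurable
      also have "\<dots> = (\<integral>\<^sup>+ x. ennreal (exp (- (l1 * ch b))) *
          (ennreal (bessel_weight l2 l3 x) * ennreal (exp (- bessel_rate l2 l3 x * ch b))) \<partial>lborel)"
        unfolding bessel_integral[OF l(2,3)] bessel_weight_def bessel_rate_def
        by (rule nn_integral_cmult[symmetric]) measurable
      also have "\<dots> = (\<integral>\<^sup>+ x. w (l, x) * ennreal (exp (- \<rho> (l, x) * ch b)) \<partial>lborel)"
      proof (rule nn_integral_cong)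
        fix x
        have "exp (- \<rho> (l, x) * ch b) = exp (- (l1 * ch b)) * exp (- bessel_rate l2 l3 x * ch b)"
          unfolding \<rho> by (simp add: exp_add[symmetric] algebra_simps)
        then show "ennreal (exp (- (l1 * ch b))) *
          (ennreal (bessel_weight l2 l3 x) * ennreal (exp (- bessel_rate l2 l3 x * ch b))) =
          w (l, x) * ennreal (exp (- \<rho> (l, x) * ch b))"
          by (simp add: w_def l_eq ennreal_mult mult_ac)
      qed
      finally show "(\<integral>\<^sup>+ q. ennreal (exp (- (fst l * ch b + fst (snd l) * ch q + snd (snd l) * ch (b - q)))) \<partial>lborel)
        = (\<integral>\<^sup>+ x. w (l, x) * ennreal (exp (- \<rho> (l, x) * ch b)) \<partial>lborel)"
        by (simp add: l_eq)
    qed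
    also have "\<dots> = \<phi> (ch b)"
      unfolding \<phi>_def by (rule lborel.nn_integral_fst) measurable
    finally show ?thesis .
  qed
  ultimately show ?thesis using that by blast
qed

lemma marginal_ucm:
  assumes F: "bcm F" and [measurable]: "(\<lambda>(s, t). F s t) \<in> borel_measurable (borel \<Otimes>\<^sub>M borel)"
    and fin: "\<And>s. (\<integral>\<^sup>+ t. F s t * ennreal (exp t) \<partial>lborel) < \<infinity>"
  shows "ucm (\<lambda>s. \<integral>\<^sup>+ t. F s t * ennreal (exp t) \<partial>lborel)"
  unfolding ucm_def
proof (intro allI conjI)
  define m where "m s = (\<integral>\<^sup>+ t. F s t * ennreal (exp t) \<partial>lborel)" for s
  fix a
  show "(\<integral>\<^sup>+ t. F a t * ennreal (exp t) \<partial>lborel) < \<infinity>" by (rule fin)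
  define \<Psi> where "\<Psi> r b = (\<integral>\<^sup>+ q. F (a + b) (r + q) * F (a - b) (r - q) \<partial>lborel)" for r b
  have [measurable]: "(\<lambda>r. \<Psi> r b) \<in> borel_measurable borel" for b
    unfolding \<Psi>_def by measurable
  have prod: "m (a + b) * m (a - b) = (\<integral>\<^sup>+ r. ennreal (2 * exp (2 * r)) * \<Psi> r b \<partial>lborel)" for b
  proof -
    have "m (a + b) * m (a - b) = (\<integral>\<^sup>+ y. F (a + b) y * ennreal (exp y) * m (a - b) \<partial>lborel)"
      unfolding m_def by (rule nn_integral_multc[symmetric]) measurable
    also have "\<dots> = (\<integral>\<^sup>+ y. \<integral>\<^sup>+ z. F (a + b) y * ennreal (exp y) * (F (a - b) z * ennreal (exp z)) \<partial>lborel \<partial>lborel)"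
      unfolding m_def by (intro nn_integral_cong nn_integral_cmult[symmetric]) measurable
    also have "\<dots> = (\<integral>\<^sup>+ r. \<integral>\<^sup>+ q. 2 * (F (a + b) (r + q) * ennreal (exp (r + q)) *
        (F (a - b) (r - q) * ennreal (exp (r - q)))) \<partial>lborel \<partial>lborel)"
      by (rule nn_integral_rotate) measurable
    also have "\<dots> = (\<integral>\<^sup>+ r. \<integral>\<^sup>+ q. ennreal (2 * exp (2 * r)) * (F (a + b) (r + q) * F (a - b) (r - q)) \<partial>lborel \<partial>lborel)"
    proof (intro nn_integral_cong)
      fix r q :: real
      have "exp (2 * r) = exp (r + q) * exp (r - q)" by (simp add: exp_add[symmetric])
      then have "ennreal (2 * exp (2 * r)) = 2 * (ennreal (exp (r + q)) * ennreal (exp (r - q)))"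
        by (simp add: ennreal_mult)
      then show "2 * (F (a + b) (r + q) * ennreal (exp (r + q)) * (F (a - b) (r - q) * ennreal (exp (r - q)))) =
         ennreal (2 * exp (2 * r)) * (F (a + b) (r + q) * F (a - b) (r - q))"
        by (simp only: mult_ac)
    qed
    also have "\<dots> = (\<integral>\<^sup>+ r. ennreal (2 * exp (2 * r)) * \<Psi> r b \<partial>lborel)"
      unfolding \<Psi>_def by (intro nn_integral_cong nn_integral_cmult) measurable
    finally show ?thesis .
  qed
  have \<Psi>_abs: "\<Psi> r \<bar>b\<bar> = \<Psi> r b" for r b
    by (rule section_product_cm[OF F assms(2), of a r]) (simp add: \<Psi>_def ch_def)
  \<comment> \<open>Evaluating at b = arcosh (1 + s / 2) expresses the product as a function of s =
    ch b by one formula that is measurable in r, in place of functions chosen separately for each r.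
    As arcosh returns |b|, evenness of \<open>\<Psi> r\<close> is used.\<close>
  define \<phi> where "\<phi> s = (\<integral>\<^sup>+ r. ennreal (2 * exp (2 * r)) * \<Psi> r (arcosh (1 + s / 2)) \<partial>lborel)" for s
  have \<phi>_ch: "m (a + b) * m (a - b) = \<phi> (ch b)" for b
    unfolding prod \<phi>_def arcosh_ch \<Psi>_abs ..
  have fin0: "(\<integral>\<^sup>+ r. ennreal (2 * exp (2 * r)) * \<Psi> r (arcosh (1 + 0 / 2)) \<partial>lborel) < \<infinity>"
    using prod[of 0] fin[of a] ennreal_mult_less_top[of "m a" "m a"] by (simp add: m_def[symmetric])
  have "cm \<phi>"
  proof (rule cm_mixture[where M=lborel and
        \<phi>="\<lambda>r s. ennreal (2 * exp (2 * r)) * \<Psi> r (arcosh (1 + s / 2))", OF _ _ fin0 \<phi>_def])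
    \<comment> \<open>At b = 0 the mixture equals the square of the finite value \<open>m a\<close>,
      so the inner integrals are finite for almost every r.\<close>
    have "AE r in lborel. ennreal (2 * exp (2 * r)) * \<Psi> r (arcosh (1 + 0 / 2)) \<noteq> \<infinity>"
      using fin0 by (intro nn_integral_PInf_AE) auto
    then show "AE r in lborel. cm (\<lambda>s. ennreal (2 * exp (2 * r)) * \<Psi> r (arcosh (1 + s / 2)))"
    proof eventually_elim
      case (elim r)
      then have fin_r: "\<Psi> r 0 < \<infinity>"
        by (auto simp: ennreal_mult_eq_top_iff top.not_eq_extremum)
      obtain \<psi> where \<psi>: "\<psi> 0 < \<infinity> \<Longrightarrow> cm \<psi>" "\<And>b. \<Psi> r b = \<psi> (ch b)"
        using section_product_cm[OF F assms(2), of a r] unfolding \<Psi>_def by metis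
      have "cm \<psi>" using \<psi>(1) \<psi>(2)[of 0] fin_r by simp
      moreover have "cm (\<lambda>s. \<Psi> r (arcosh (1 + s / 2))) \<longleftrightarrow> cm \<psi>"
        by (rule cm_cong) (simp add: \<psi>(2) ch_arcosh)
      ultimately show ?case by (intro cm_cmult) simp_all
    qed
  qed measurable
  with \<phi>_ch show "\<exists>\<phi>. cm \<phi> \<and> (\<forall>b. (\<integral>\<^sup>+ t. F (a + b) t * ennreal (exp t) \<partial>lborel) *
      (\<integral>\<^sup>+ t. F (a - b) t * ennreal (exp t) \<partial>lborel) = \<phi> (ch b))"
    unfolding m_def by blast
qed

section \<open>Sections, positivity, and finiteness of section integrals\<close>

lemma section_ucm:
  assumes F: "bcm F"
  shows "ucm (\<lambda>s. F s t)"
  unfolding ucm_def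
proof (intro allI conjI)
  fix a
  show "F a t < \<infinity>" by (rule bcm_finite[OF F])
  obtain P where P: "sets P = sets (borel \<Otimes>\<^sub>M (borel \<Otimes>\<^sub>M borel))" "finite_measure P"
    "AE l in P. 0 \<le> fst l \<and> 0 \<le> fst (snd l) \<and> 0 \<le> snd (snd l)"
    "\<And>b1 b2. F (a + b1) (t + b2) * F (a - b1) (t - b2) =
        (\<integral>\<^sup>+ l. ennreal (exp (- (fst l * ch b1 + fst (snd l) * ch b2 + snd (snd l) * ch (b1 - b2)))) \<partial>P)"
    by (rule bcm_atE[OF F, of a t]) blast
  note [measurable_cong] = P(1)
  \<comment> \<open>With b2 = 0 the first and third arguments coincide and the second vanishes, so
    the rates l1 and l3 add up.\<close>
  define \<phi> where "\<phi> s = (\<integral>\<^sup>+ l. 1 * ennreal (exp (- (fst l + snd (snd l)) * s)) \<partial>P)" for s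
  have "cm \<phi>"
  proof (rule cmI[OF _ _ _ _ \<phi>_def])
    show "AE l in P. 0 \<le> fst l + snd (snd l)" using P(3) by eventually_elim simp
    show "(\<integral>\<^sup>+ l. 1 \<partial>P) < \<infinity>"
      using finite_measure.emeasure_finite[OF P(2)] by (simp add: top.not_eq_extremum)
  qed measurable
  moreover have "F (a + b) t * F (a - b) t = \<phi> (ch b)" for b
    using P(4)[of b 0] by (simp add: \<phi>_def algebra_simps)
  ultimately show "\<exists>\<phi>. cm \<phi> \<and> (\<forall>b. F (a + b) t * F (a - b) t = \<phi> (ch b))" by blast
qed

lemma ucm_cmult:
  assumes g: "ucm g" and c: "c < \<infinity>"
  shows "ucm (\<lambda>s. g s * c)"
  unfolding ucm_def
proof (intro allI conjI)
  fix a
  obtain \<phi> where \<phi>: "cm \<phi>" "\<And>b. g (a + b) * g (a - b) = \<phi> (ch b)" and ga: "g a < \<infinity>"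
    using g unfolding ucm_def by blast
  show "g a * c < \<infinity>" using ga c by (simp add: ennreal_mult_less_top)
  have "cm (\<lambda>s. c * c * \<phi> s)"
    using \<phi>(1) c by (intro cm_cmult) (auto simp: ennreal_mult_less_top)
  moreover have "g (a + b) * c * (g (a - b) * c) = c * c * \<phi> (ch b)" for b
    unfolding \<phi>(2)[symmetric] by (simp only: mult_ac)
  ultimately show "\<exists>\<phi>. cm \<phi> \<and> (\<forall>b. g (a + b) * c * (g (a - b) * c) = \<phi> (ch b))"
    by blast
qed

text \<open>The products are integrals of strictly positive functions. If one of them vanishes, then
  the measure at that centre is zero, and so is the square of the value at the centre.\<close>

lemma bcm_pos:
  assumes F: "bcm F" and "0 < F s t"
  shows "0 < F s' t'"
proof -
  obtain P where P: "sets P = sets (borel \<Otimes>\<^sub>M (borel \<Otimes>\<^sub>M borel))" "finite_measure P"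
    "AE l in P. 0 \<le> fst l \<and> 0 \<le> fst (snd l) \<and> 0 \<le> snd (snd l)"
    "\<And>b1 b2. F (s + b1) (t + b2) * F (s - b1) (t - b2) =
        (\<integral>\<^sup>+ l. ennreal (exp (- (fst l * ch b1 + fst (snd l) * ch b2 + snd (snd l) * ch (b1 - b2)))) \<partial>P)"
    by (rule bcm_atE[OF F, of s t]) blast
  note [measurable_cong] = P(1)
  have "F s' t' \<noteq> 0"
  proof
    assume "F s' t' = 0"
    then have "AE l in P. ennreal (exp (- (fst l * ch (s' - s) + fst (snd l) * ch (t' - t) +
        snd (snd l) * ch (s' - s - (t' - t))))) = 0"
      using P(4)[of "s' - s" "t' - t"] by (subst nn_integral_0_iff_AE[symmetric]) auto
    then have "AE l in P. False" by (auto elim!: eventually_mono)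
    then have "emeasure P (space P) = 0"
      using emeasure_eq_0_AE[of "\<lambda>_. True" P] by simp
    then show False using P(4)[of 0 0] \<open>0 < F s t\<close> by simp
  qed
  then show ?thesis by (simp add: zero_less_iff_neq_zero)
qed

text \<open>A two-point comparison in the manner of total positivity: moving from \<open>x - m\<close> to \<open>0\<close> in the first
  coordinate increases none of the three arguments when \<open>x - m\<close> and \<open>t\<close> have opposite signs.\<close>

lemma bcm_compare:
  assumes F: "bcm F" and le: "(x - m) * t \<le> 0"
  shows "F x t * F (2 * m - x) 0 \<le> F m t * F m 0"
proof -
  \<comment> \<open>The centre (m, t / 2) is the midpoint both of (x, t), (2 m - x, 0) and of (m,
    t), (m, 0), so one measure represents both products.\<close>
  obtain P where P: "sets P = sets (borel \<Otimes>\<^sub>M (borel \<Otimes>\<^sub>M borel))" "finite_measure P"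
    "AE l in P. 0 \<le> fst l \<and> 0 \<le> fst (snd l) \<and> 0 \<le> snd (snd l)"
    "\<And>b1 b2. F (m + b1) (t / 2 + b2) * F (m - b1) (t / 2 - b2) =
        (\<integral>\<^sup>+ l. ennreal (exp (- (fst l * ch b1 + fst (snd l) * ch b2 + snd (snd l) * ch (b1 - b2)))) \<partial>P)"
    by (rule bcm_atE[OF F, of m "t / 2"]) blast
  \<comment> \<open>For opposite signs the left-out shift only adds: |x - m - t / 2| = |x - m| + |t|
    / 2.\<close>
  have abs: "\<bar>0 - t / 2\<bar> \<le> \<bar>x - m - t / 2\<bar>"
    using le by (cases "0 \<le> t"; cases "x \<le> m") (auto simp: mult_le_0_iff abs_if)
  have "F x t * F (2 * m - x) 0 = F (m + (x - m)) (t / 2 + t / 2) * F (m - (x - m)) (t / 2 - t / 2)"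
    by simp
  also have "\<dots> \<le> F (m + 0) (t / 2 + t / 2) * F (m - 0) (t / 2 - t / 2)"
    unfolding P(4)
  proof (rule nn_integral_mono_AE, use P(3) in eventually_elim)
    fix l :: "real \<times> real \<times> real"
    assume l: "0 \<le> fst l \<and> 0 \<le> fst (snd l) \<and> 0 \<le> snd (snd l)"
    have "fst l * ch 0 \<le> fst l * ch (x - m)"
      using l ch_nonneg by (simp add: mult_nonneg_nonneg)
    moreover have "snd (snd l) * ch (0 - t / 2) \<le> snd (snd l) * ch (x - m - t / 2)"
      using l ch_mono[OF abs] by (intro mult_left_mono) auto
    ultimately show "ennreal (exp (- (fst l * ch (x - m) + fst (snd l) * ch (t / 2) + snd (snd l) * ch (x - m - t / 2))))
       \<le> ennreal (exp (- (fst l * ch 0 + fst (snd l) * ch (t / 2) + snd (snd l) * ch (0 - t / 2))))"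
      by (intro ennreal_leI) simp
  qed
  finally show ?thesis by simp
qed

lemma AE_lborel_obtain:
  fixes a b :: real
  assumes "AE x in lborel. p x" "a < b"
  obtains x where "a < x" "x < b" "p x"
proof -
  have "\<exists>x\<in>{a<..<b}. p x"
  proof (rule ccontr)
    assume "\<not> ?thesis"
    then have "AE x in lborel. x \<notin> {a<..<b}"
      using assms(1) by (auto elim!: eventually_mono)
    then have "emeasure lborel {a<..<b} = 0"
      by (subst (asm) AE_iff_measurable[of "{a<..<b}"]) auto
    then show False using assms(2) by simp
  qed
  then show ?thesis using that by auto
qed

text \<open>Fubini provides good lines on both sides of x. A good \<open>m1 > x\<close> controls the
  half t \<ge> 0 and a good \<open>m2 < x\<close> the half t < 0, since \<open>bcm_compare\<close>
  needs x - m and t of opposite signs.\<close>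

lemma bcm_section_integral_finite:
  assumes F: "bcm F" and [measurable]: "(\<lambda>(s, t). F s t) \<in> borel_measurable (borel \<Otimes>\<^sub>M borel)"
    and pos: "\<And>s t. 0 < F s t"
    and fin: "(\<integral>\<^sup>+ s. \<integral>\<^sup>+ t. F s t * ennreal (exp (s + t)) \<partial>lborel \<partial>lborel) < \<infinity>"
  shows "(\<integral>\<^sup>+ t. F x t * ennreal (exp t) \<partial>lborel) < \<infinity>"
proof -
  let ?m = "\<lambda>s. \<integral>\<^sup>+ t. F s t * ennreal (exp t) \<partial>lborel"
  have "AE s in lborel. (\<integral>\<^sup>+ t. F s t * ennreal (exp (s + t)) \<partial>lborel) \<noteq> \<infinity>"
    using fin by (intro nn_integral_PInf_AE) auto
  then have ae: "AE s in lborel. ?m s < \<infinity>"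
  proof eventually_elim
    case (elim s)
    have "(\<integral>\<^sup>+ t. F s t * ennreal (exp (s + t)) \<partial>lborel) = (\<integral>\<^sup>+ t. ennreal (exp s) * (F s t * ennreal (exp t)) \<partial>lborel)"
      by (simp add: exp_add ennreal_mult mult_ac)
    also have "\<dots> = ennreal (exp s) * ?m s"
      by (rule nn_integral_cmult) measurable
    finally show ?case
      using elim by (auto simp: ennreal_mult_eq_top_iff top.not_eq_extremum)
  qed
  have bound: "\<exists>C<\<infinity>. \<forall>t. (x - m) * t \<le> 0 \<longrightarrow> F x t \<le> C * F m t" for m
  proof (intro exI conjI allI impI)
    \<comment> \<open>Dividing the comparison by this value gives the constant; positivity and
      finiteness of F make the division legitimate.\<close>
    let ?D = "F (2 * m - x) 0"
    have D: "?D \<noteq> 0" "?D \<noteq> \<top>"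
      using pos[of "2 * m - x" 0] bcm_finite[OF F, of "2 * m - x" 0] by auto
    show "F m 0 / ?D < \<infinity>"
      using bcm_finite[OF F, of m 0] D by (auto simp: ennreal_divide_eq_top_iff top.not_eq_extremum[symmetric])
    fix t assume "(x - m) * t \<le> 0"
    from bcm_compare[OF F this] have "F x t * ?D / ?D \<le> F m t * F m 0 / ?D"
      by (rule divide_right_mono_ennreal)
    then show "F x t \<le> F m 0 / ?D * F m t"
      using D by (simp add: ennreal_mult_divide_eq mult_ac ennreal_times_divide)
  qed
  obtain m1 where m1: "x < m1" "?m m1 < \<infinity>"
    using AE_lborel_obtain[OF ae, of x "x + 1"] by auto
  obtain m2 where m2: "m2 < x" "?m m2 < \<infinity>"
    using AE_lborel_obtain[OF ae, of "x - 1" x] by auto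
  obtain C1 C2 where C: "C1 < \<infinity>" "\<And>t. (x - m1) * t \<le> 0 \<Longrightarrow> F x t \<le> C1 * F m1 t"
    "C2 < \<infinity>" "\<And>t. (x - m2) * t \<le> 0 \<Longrightarrow> F x t \<le> C2 * F m2 t"
    using bound[of m1] bound[of m2] by blast
  have "F x t * ennreal (exp t) \<le> C1 * (F m1 t * ennreal (exp t)) + C2 * (F m2 t * ennreal (exp t))" for t
  proof (cases "0 \<le> t")
    case True
    then have "F x t \<le> C1 * F m1 t" using m1 by (intro C) (simp add: mult_nonpos_nonneg)
    then have "F x t * ennreal (exp t) \<le> C1 * F m1 t * ennreal (exp t)" by (rule mult_right_mono) simp
    then show ?thesis by (simp add: mult.assoc add_increasing2)
  next
    case False
    then have "F x t \<le> C2 * F m2 t" using m2 by (intro C) (simp add: mult_nonneg_nonpos)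
    then have "F x t * ennreal (exp t) \<le> C2 * F m2 t * ennreal (exp t)" by (rule mult_right_mono) simp
    then show ?thesis by (simp add: mult.assoc add_increasing)
  qed
  then have "?m x \<le> (\<integral>\<^sup>+ t. C1 * (F m1 t * ennreal (exp t)) + C2 * (F m2 t * ennreal (exp t)) \<partial>lborel)"
    by (intro nn_integral_mono) simp
  also have "\<dots> = C1 * ?m m1 + C2 * ?m m2"
    by (subst nn_integral_add) (simp_all add: nn_integral_cmult)
  also have "\<dots> < \<infinity>"
    using C(1,3) m1(2) m2(2) by (simp add: ennreal_mult_less_top)
  finally show ?thesis .
qed

section \<open>Transfer to the quadrant\<close>

text \<open>As v + 1 / v exceeds ch (ln v) by 2, the density exp (2 l) compensates the shift. The
  resulting measure may be infinite, which the definition of HCM allows.\<close>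

lemma HCM_of_ucm:
  assumes g: "ucm g" and h: "\<And>s. h (exp s) = g s"
  shows "HCM h"
  unfolding HCM_def
proof (intro conjI allI impI)
  fix x :: real assume "0 < x"
  then show "h x < \<infinity>" using h[of "ln x"] g unfolding ucm_def by auto
next
  fix u :: real assume u: "0 < u"
  obtain \<phi> where "cm \<phi>" and \<phi>: "\<And>b. g (ln u + b) * g (ln u - b) = \<phi> (ch b)"
    using g unfolding ucm_def by blast
  from \<open>cm \<phi>\<close> obtain P where P: "sets P = sets borel" "AE l in P. 0 \<le> l"
    "\<And>s. 0 \<le> s \<Longrightarrow> \<phi> s = (\<integral>\<^sup>+ l. ennreal (exp (- l * s)) \<partial>P)"
    unfolding cm_def by blast
  note [measurable_cong] = P(1)
  let ?\<nu> = "restrict_space (density P (\<lambda>l. ennreal (exp (2 * l)))) {0..}"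
  show "\<exists>\<nu>. sets \<nu> = sets (restrict_space borel {0..}) \<and>
      (\<forall>v>0. h (u * v) * h (u / v) = (\<integral>\<^sup>+ l. ennreal (exp (- l * (v + 1 / v))) \<partial>\<nu>))"
  proof (intro exI[of _ ?\<nu>] conjI allI impI)
    show "sets ?\<nu> = sets (restrict_space borel {0..})"
      using P(1) by (intro sets_restrict_space_cong) simp
    fix v :: real assume v: "0 < v"
    have ch: "v + 1 / v = ch (ln v) + 2"
      using ch_exp[of "ln v"] v by (simp add: exp_minus inverse_eq_divide)
    have "h (u * v) * h (u / v) = g (ln u + ln v) * g (ln u - ln v)"
      using u v by (simp add: h[symmetric] exp_add exp_diff)
    also have "\<dots> = (\<integral>\<^sup>+ l. ennreal (exp (- l * ch (ln v))) \<partial>P)"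
      unfolding \<phi> by (rule P(3)[OF ch_nonneg])
    also have "\<dots> = (\<integral>\<^sup>+ l. ennreal (exp (2 * l)) * (ennreal (exp (- l * (v + 1 / v))) * indicator {0..} l) \<partial>P)"
      by (rule nn_integral_cong_AE, use P(2) in eventually_elim)
        (simp add: ch ennreal_mult[symmetric] exp_add[symmetric] algebra_simps)
    also have "\<dots> = (\<integral>\<^sup>+ l. ennreal (exp (- l * (v + 1 / v))) * indicator {0..} l \<partial>density P (\<lambda>l. ennreal (exp (2 * l))))"
      by (rule nn_integral_density[symmetric]) measurable
    also have "\<dots> = (\<integral>\<^sup>+ l. ennreal (exp (- l * (v + 1 / v))) \<partial>?\<nu>)"
      using P(1) by (intro nn_integral_restrict_space[symmetric]) simp
    finally show "h (u * v) * h (u / v) = (\<integral>\<^sup>+ l. ennreal (exp (- l * (v + 1 / v))) \<partial>?\<nu>)" .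
  qed
qed

lemma ch_quotient: "exp b1 / exp b2 + exp b2 / exp b1 = ch (b1 - b2) + 2"
  using ch_exp[of "b1 - b2"] by (simp add: exp_diff)

lemma ch_inverse: "exp b + 1 / exp b = ch b + 2"
  using ch_quotient[of b 0] by simp

text \<open>The shift by 2 in each argument is absorbed into the density exp (- 2 (l1 + l2 + l3)).
  This also turns a possibly infinite measure into one of mass f (exp a1, exp a2) squared, hence a
  finite one.\<close>

lemma bcm_of_BVHCM:
  assumes f: "BVHCM f"
  shows "bcm (\<lambda>s t. f (exp s, exp t))"
  unfolding bcm_def
proof (intro allI conjI)
  fix a1 a2 :: real
  show "f (exp a1, exp a2) < \<infinity>"
    using f unfolding BVHCM_def by simp
  let ?S = "{0..} \<times> {0..} \<times> {0..} :: (real \<times> real \<times> real) set"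
  obtain \<nu> :: "(real \<times> real \<times> real) measure" where "sets \<nu> = sets (restrict_space borel ?S) \<and>
     (\<forall>v1>0. \<forall>v2>0. f (exp a1 * v1, exp a2 * v2) * f (exp a1 / v1, exp a2 / v2) =
       (\<integral>\<^sup>+ (l1, l2, l3). ennreal (exp (- l1 * (v1 + 1 / v1) - l2 * (v2 + 1 / v2)
                                              - l3 * (v1 / v2 + v2 / v1))) \<partial>\<nu>))"
    using f[unfolded BVHCM_def, THEN conjunct2, THEN spec, THEN mp, OF exp_gt_zero[of a1],
        THEN spec, THEN mp, OF exp_gt_zero[of a2]] by (rule exE)
  note \<nu> = this[THEN conjunct1] this[THEN conjunct2, rule_format]
  have space: "space \<nu> = ?S"
    using sets_eq_imp_space_eq[OF \<nu>(1)] by (simp add: space_restrict_space)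
  have id: "(\<lambda>l. l) \<in> \<nu> \<rightarrow>\<^sub>M borel \<Otimes>\<^sub>M (borel \<Otimes>\<^sub>M borel)"
    by (simp only: measurable_cong_sets[OF \<nu>(1) refl] borel_prod) (rule measurable_restrict_space1, simp)
  have [measurable]: "fst \<in> borel_measurable \<nu>" "(\<lambda>l. fst (snd l)) \<in> borel_measurable \<nu>"
      "(\<lambda>l. snd (snd l)) \<in> borel_measurable \<nu>"
    by (rule measurable_compose[OF id], measurable)+
  show "bcm_at (\<lambda>s t. f (exp s, exp t)) a1 a2"
  proof (rule bcm_atI[where M=\<nu> and ?x1.0=fst and ?x2.0="\<lambda>l. fst (snd l)" and ?x3.0="\<lambda>l. snd (snd l)"
        and c="\<lambda>l. ennreal (exp (- 2 * (fst l + fst (snd l) + snd (snd l))))"])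
    show "AE l in \<nu>. 0 \<le> fst l \<and> 0 \<le> fst (snd l) \<and> 0 \<le> snd (snd l)"
      by (rule AE_I2) (auto simp: space)
    fix b1 b2
    have eq: "exp (- fst l * (exp b1 + 1 / exp b1) - fst (snd l) * (exp b2 + 1 / exp b2) -
         snd (snd l) * (exp b1 / exp b2 + exp b2 / exp b1)) =
       exp (- 2 * (fst l + fst (snd l) + snd (snd l))) *
         exp (- (fst l * ch b1 + fst (snd l) * ch b2 + snd (snd l) * ch (b1 - b2)))" for l :: "real \<times> real \<times> real"
      unfolding ch_quotient ch_inverse by (simp add: exp_add[symmetric] algebra_simps)
    show "f (exp (a1 + b1), exp (a2 + b2)) * f (exp (a1 - b1), exp (a2 - b2)) =
       (\<integral>\<^sup>+ l. ennreal (exp (- 2 * (fst l + fst (snd l) + snd (snd l)))) *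
          ennreal (exp (- (fst l * ch b1 + fst (snd l) * ch b2 + snd (snd l) * ch (b1 - b2)))) \<partial>\<nu>)"
      unfolding exp_add[of a1 b1] exp_add[of a2 b2] exp_diff[of a1 b1] exp_diff[of a2 b2]
        \<nu>(2)[OF exp_gt_zero exp_gt_zero] case_prod_beta eq
      by (simp only: ennreal_mult exp_ge_zero)
  qed measurable
qed

lemma BVHCM_of_bcm:
  assumes F: "bcm F" and f: "\<And>s t. f (exp s, exp t) = F s t"
  shows "BVHCM f"
  unfolding BVHCM_def
proof (intro conjI allI impI)
  fix x y :: real assume "0 < x" "0 < y"
  then show "f (x, y) < \<infinity>" using f[of "ln x" "ln y"] bcm_finite[OF F] by simp
next
  fix u1 u2 :: real assume u: "0 < u1" "0 < u2"
  obtain P where P: "sets P = sets (borel \<Otimes>\<^sub>M (borel \<Otimes>\<^sub>M borel))" "finite_measure P"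
    "AE l in P. 0 \<le> fst l \<and> 0 \<le> fst (snd l) \<and> 0 \<le> snd (snd l)"
    "\<And>b1 b2. F (ln u1 + b1) (ln u2 + b2) * F (ln u1 - b1) (ln u2 - b2) =
        (\<integral>\<^sup>+ l. ennreal (exp (- (fst l * ch b1 + fst (snd l) * ch b2 + snd (snd l) * ch (b1 - b2)))) \<partial>P)"
    by (rule bcm_atE[OF F, of "ln u1" "ln u2"]) blast
  note [measurable_cong] = P(1)
  let ?S = "{0..} \<times> {0..} \<times> {0..} :: (real \<times> real \<times> real) set"
  define D where "D = density P (\<lambda>l. ennreal (exp (2 * (fst l + fst (snd l) + snd (snd l)))))"
  have sets_D: "sets D = sets borel"
    by (simp only: D_def sets_density P(1) borel_prod)
  have S: "?S \<in> sets borel" by (intro borel_closed closed_Times) auto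
  then have [measurable]: "?S \<in> sets P" by (simp only: P(1) borel_prod)
  show "\<exists>\<nu> :: (real \<times> real \<times> real) measure. sets \<nu> = sets (restrict_space borel ?S) \<and>
        (\<forall>v1>0. \<forall>v2>0. f (u1 * v1, u2 * v2) * f (u1 / v1, u2 / v2) =
           (\<integral>\<^sup>+ (l1, l2, l3). ennreal (exp (- l1 * (v1 + 1 / v1) - l2 * (v2 + 1 / v2)
                                              - l3 * (v1 / v2 + v2 / v1))) \<partial>\<nu>))"
  proof (intro exI[of _ "restrict_space D ?S"] conjI allI impI)
    show "sets (restrict_space D ?S) = sets (restrict_space borel ?S)"
      by (rule sets_restrict_space_cong[OF sets_D])
    fix v1 v2 :: real assume v: "0 < v1" "0 < v2"
    let ?g = "\<lambda>l. ennreal (exp (- fst l * (v1 + 1 / v1) - fst (snd l) * (v2 + 1 / v2) - snd (snd l) * (v1 / v2 + v2 / v1)))"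
    have "f (u1 * v1, u2 * v2) * f (u1 / v1, u2 / v2) =
        F (ln u1 + ln v1) (ln u2 + ln v2) * F (ln u1 - ln v1) (ln u2 - ln v2)"
      using u v by (simp add: f[symmetric] exp_add exp_diff)
    also have "\<dots> = (\<integral>\<^sup>+ l. ennreal (exp (- (fst l * ch (ln v1) + fst (snd l) * ch (ln v2) + snd (snd l) * ch (ln v1 - ln v2)))) \<partial>P)"
      by (rule P(4))
    also have "\<dots> = (\<integral>\<^sup>+ l. ennreal (exp (2 * (fst l + fst (snd l) + snd (snd l)))) * (?g l * indicator ?S l) \<partial>P)"
    proof (rule nn_integral_cong_AE, use P(3) in eventually_elim)
      fix l :: "real \<times> real \<times> real"
      assume "0 \<le> fst l \<and> 0 \<le> fst (snd l) \<and> 0 \<le> snd (snd l)"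
      then have "l \<in> ?S" by (auto simp: mem_Times_iff)
      have ch: "v1 + 1 / v1 = ch (ln v1) + 2" "v2 + 1 / v2 = ch (ln v2) + 2"
          "v1 / v2 + v2 / v1 = ch (ln v1 - ln v2) + 2"
        using ch_inverse[of "ln v1"] ch_inverse[of "ln v2"] ch_quotient[of "ln v1" "ln v2"] v by simp_all
      have "exp (- (fst l * ch (ln v1) + fst (snd l) * ch (ln v2) + snd (snd l) * ch (ln v1 - ln v2))) =
        exp (2 * (fst l + fst (snd l) + snd (snd l))) *
        exp (- fst l * (v1 + 1 / v1) - fst (snd l) * (v2 + 1 / v2) - snd (snd l) * (v1 / v2 + v2 / v1))"
        unfolding ch by (simp add: exp_add[symmetric] algebra_simps)
      then show "ennreal (exp (- (fst l * ch (ln v1) + fst (snd l) * ch (ln v2) + snd (snd l) * ch (ln v1 - ln v2)))) =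
        ennreal (exp (2 * (fst l + fst (snd l) + snd (snd l)))) * (?g l * indicator ?S l)"
        using \<open>l \<in> ?S\<close> by (simp add: ennreal_mult)
    qed
    also have "\<dots> = (\<integral>\<^sup>+ l. ?g l * indicator ?S l \<partial>D)"
      unfolding D_def by (rule nn_integral_density[symmetric]) measurable
    also have "\<dots> = (\<integral>\<^sup>+ l. ?g l \<partial>restrict_space D ?S)"
      using S sets_D by (intro nn_integral_restrict_space[symmetric]) (simp add: sets_eq_imp_space_eq)
    finally show "f (u1 * v1, u2 * v2) * f (u1 / v1, u2 / v2) =
        (\<integral>\<^sup>+ (l1, l2, l3). ennreal (exp (- l1 * (v1 + 1 / v1) - l2 * (v2 + 1 / v2)
                                              - l3 * (v1 / v2 + v2 / v1))) \<partial>restrict_space D ?S)"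
      unfolding case_prod_beta .
  qed
qed

section \<open>Integration over the half-line and the quadrant in logarithmic coordinates\<close>

lemma nn_integral_exp_subst:
  assumes [measurable]: "g \<in> borel_measurable borel"
  shows "(\<integral>\<^sup>+ x\<in>{0<..}. g x \<partial>lborel) = (\<integral>\<^sup>+ s. g (exp s) * ennreal (exp s) \<partial>lborel)"
proof -
  \<comment> \<open>The substitution is made on compact intervals, kept nondegenerate by
    \<open>Suc n\<close>, and extended by monotone convergence.\<close>
  have eq: "(\<integral>\<^sup>+ x. g x * indicator {exp (- real (Suc n))..exp (real (Suc n))} x \<partial>lborel) =
      (\<integral>\<^sup>+ s. g (exp s) * ennreal (exp s) * indicator {- real (Suc n)..real (Suc n)} s \<partial>lborel)" for n
    by (rule nn_integral_substitution_aux) (auto intro!: derivative_eq_intros continuous_intros)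
  have "(\<lambda>n. \<integral>\<^sup>+ x. g x * indicator {exp (- real (Suc n))..exp (real (Suc n))} x \<partial>lborel)
      \<longlonglongrightarrow> (\<integral>\<^sup>+ x\<in>{0<..}. g x \<partial>lborel)"
  proof (rule nn_integral_LIMSEQ)
    show "incseq (\<lambda>n x. g x * indicator {exp (- real (Suc n))..exp (real (Suc n))} x)"
    proof (intro incseq_SucI le_funI mult_left_mono)
      fix n and x :: real
      have "exp (- real (Suc (Suc n))) \<le> exp (- real (Suc n))" "exp (real (Suc n)) \<le> exp (real (Suc (Suc n)))"
        by simp_all
      then have "{exp (- real (Suc n))..exp (real (Suc n))} \<subseteq> {exp (- real (Suc (Suc n)))..exp (real (Suc (Suc n)))}"
        by (simp only: atLeastatMost_subset_iff) blast
      then show "indicator {exp (- real (Suc n))..exp (real (Suc n))} x \<le>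
          (indicator {exp (- real (Suc (Suc n)))..exp (real (Suc (Suc n)))} x :: ennreal)"
        by (intro indicator_leI) blast
    qed simp
    fix x :: real
    show "(\<lambda>n. g x * indicator {exp (- real (Suc n))..exp (real (Suc n))} x) \<longlonglongrightarrow> g x * indicator {0<..} x"
    proof (cases "0 < x")
      case True
      obtain N where N: "\<bar>ln x\<bar> \<le> real N" using real_arch_simple by blast
      have "g x * indicator {exp (- real (Suc n))..exp (real (Suc n))} x = g x * indicator {0<..} x" if "N \<le> n" for n
      proof -
        have "- real (Suc n) \<le> ln x" "ln x \<le> real (Suc n)" using N that by auto
        then have "exp (- real (Suc n)) \<le> exp (ln x)" "exp (ln x) \<le> exp (real (Suc n))"
          by (simp_all only: exp_le_cancel_iff)
        then show ?thesis using True by (simp add: indicator_def)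
      qed
      then show ?thesis
        by (intro tendsto_eventually) (auto simp: eventually_sequentially)
    next
      case False
      have "x \<notin> {exp (- real (Suc n))..exp (real (Suc n))}" for n
      proof
        assume "x \<in> {exp (- real (Suc n))..exp (real (Suc n))}"
        then have "exp (- real (Suc n)) \<le> x" by (simp only: atLeastAtMost_iff)
        with exp_gt_zero have "0 < x" by (rule less_le_trans)
        with False show False ..
      qed
      then have "g x * indicator {exp (- real (Suc n))..exp (real (Suc n))} x = g x * indicator {0<..} x" for n
        using False by (simp only: indicator_simps greaterThan_iff not_False_eq_True)
      then show ?thesis by (simp only: tendsto_const)
    qed
  qed measurable
  moreover have "(\<lambda>n. \<integral>\<^sup>+ s. g (exp s) * ennreal (exp s) * indicator {- real (Suc n)..real (Suc n)} s \<partial>lborel)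
      \<longlonglongrightarrow> (\<integral>\<^sup>+ s. g (exp s) * ennreal (exp s) \<partial>lborel)"
  proof (rule nn_integral_LIMSEQ)
    show "incseq (\<lambda>n s. g (exp s) * ennreal (exp s) * indicator {- real (Suc n)..real (Suc n)} s)"
      by (auto simp: incseq_def le_fun_def indicator_def)
    fix s :: real
    obtain N where N: "\<bar>s\<bar> \<le> real N" using real_arch_simple by blast
    then have "g (exp s) * ennreal (exp s) * indicator {- real (Suc n)..real (Suc n)} s = g (exp s) * ennreal (exp s)"
      if "N \<le> n" for n using that by (auto simp: indicator_def)
    then show "(\<lambda>n. g (exp s) * ennreal (exp s) * indicator {- real (Suc n)..real (Suc n)} s)
        \<longlonglongrightarrow> g (exp s) * ennreal (exp s)"
      by (intro tendsto_eventually) (auto simp: eventually_sequentially)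
  qed measurable
  ultimately show ?thesis
    unfolding eq by (rule LIMSEQ_unique)
qed

lemma space_quadrant: "space quadrant = {0<..} \<times> {0<..}"
  by (simp add: quadrant_def space_restrict_space)

lemma quadrant_set: "{0<..} \<times> {0<..} \<in> sets (borel :: (real \<times> real) measure)"
  by (intro borel_open open_Times) auto

text \<open>A density is measurable only on the quadrant. Its extension by zero is measurable on the
  plane, so sections and compositions can be integrated over the line; at points (exp s, exp t)
  nothing changes.\<close>

lemma quadrant_extend:
  assumes "g \<in> borel_measurable quadrant"
  shows "(\<lambda>z. g z * indicator ({0<..} \<times> {0<..}) z :: ennreal) \<in> borel_measurable (borel \<Otimes>\<^sub>M borel)"
  using assms quadrant_set unfolding quadrant_def borel_prod
  by (subst (asm) borel_measurable_restrict_space_iff_ennreal) auto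

lemma nn_integral_quadrant:
  assumes g: "g \<in> borel_measurable quadrant"
  shows "(\<integral>\<^sup>+ z. g z \<partial>quadrant) =
    (\<integral>\<^sup>+ s. \<integral>\<^sup>+ t. g (exp s, exp t) * ennreal (exp (s + t)) \<partial>lborel \<partial>lborel)"
proof -
  define G where "G z = g z * indicator ({0<..} \<times> {0<..}) z" for z
  have [measurable]: "G \<in> borel_measurable (borel \<Otimes>\<^sub>M borel)"
    unfolding G_def by (rule quadrant_extend[OF g])
  have "(\<integral>\<^sup>+ z. g z \<partial>quadrant) = (\<integral>\<^sup>+ z. G z \<partial>(lborel \<Otimes>\<^sub>M lborel))"
    unfolding quadrant_def G_def lborel_prod
    using quadrant_set by (intro nn_integral_restrict_space) simp
  also have "\<dots> = (\<integral>\<^sup>+ x. \<integral>\<^sup>+ y. G (x, y) \<partial>lborel \<partial>lborel)"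
    by (rule lborel.nn_integral_fst[symmetric]) measurable
  also have "\<dots> = (\<integral>\<^sup>+ x\<in>{0<..}. (\<integral>\<^sup>+ y\<in>{0<..}. G (x, y) \<partial>lborel) \<partial>lborel)"
    by (intro nn_integral_cong) (auto simp: G_def indicator_def intro!: nn_integral_cong)
  also have "\<dots> = (\<integral>\<^sup>+ x\<in>{0<..}. (\<integral>\<^sup>+ t. G (x, exp t) * ennreal (exp t) \<partial>lborel) \<partial>lborel)"
    by (subst nn_integral_exp_subst) measurable
  also have "\<dots> = (\<integral>\<^sup>+ s. (\<integral>\<^sup>+ t. G (exp s, exp t) * ennreal (exp t) \<partial>lborel) * ennreal (exp s) \<partial>lborel)"
    by (rule nn_integral_exp_subst) measurable
  also have "\<dots> = (\<integral>\<^sup>+ s. \<integral>\<^sup>+ t. G (exp s, exp t) * ennreal (exp t) * ennreal (exp s) \<partial>lborel \<partial>lborel)"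
    by (intro nn_integral_cong nn_integral_multc[symmetric]) measurable
  also have "\<dots> = (\<integral>\<^sup>+ s. \<integral>\<^sup>+ t. g (exp s, exp t) * ennreal (exp (s + t)) \<partial>lborel \<partial>lborel)"
    by (intro nn_integral_cong) (simp add: G_def exp_add ennreal_mult mult_ac)
  finally show ?thesis .
qed

lemma measurable_log_coordinates:
  assumes g: "g \<in> borel_measurable quadrant"
  shows "(\<lambda>(s, t). g (exp s, exp t) :: ennreal) \<in> borel_measurable (borel \<Otimes>\<^sub>M borel)"
proof -
  have "(\<lambda>(s, t). g (exp s, exp t)) =
      (\<lambda>w. (\<lambda>z. g z * indicator ({0<..} \<times> {0<..}) z) (exp (fst w), exp (snd w)))"
    by (auto simp: fun_eq_iff)
  moreover have "(\<lambda>w. (\<lambda>z. g z * indicator ({0<..} \<times> {0<..}) z) (exp (fst w), exp (snd w)))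
      \<in> borel_measurable (borel \<Otimes>\<^sub>M borel)"
    by (rule measurable_compose[OF _ quadrant_extend[OF g]]) measurable
  ultimately show ?thesis by (simp only:)
qed

lemma nn_integral_section_log:
  assumes g: "g \<in> borel_measurable quadrant" and x: "0 < x"
  shows "(\<integral>\<^sup>+ y\<in>{0<..}. g (x, y) \<partial>lborel) = (\<integral>\<^sup>+ t. g (x, exp t) * ennreal (exp t) \<partial>lborel)"
    "(\<integral>\<^sup>+ y\<in>{0<..}. g (y, x) \<partial>lborel) = (\<integral>\<^sup>+ t. g (exp t, x) * ennreal (exp t) \<partial>lborel)"
proof -
  define G where "G z = g z * indicator ({0<..} \<times> {0<..}) z" for z
  have [measurable]: "G \<in> borel_measurable (borel \<Otimes>\<^sub>M borel)"
    unfolding G_def by (rule quadrant_extend[OF g])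
  have G: "G (x, y) = g (x, y)" "G (y, x) = g (y, x)" if "0 < y" for y
    using that x by (simp_all add: G_def)
  have "(\<integral>\<^sup>+ y\<in>{0<..}. g (x, y) \<partial>lborel) = (\<integral>\<^sup>+ y\<in>{0<..}. G (x, y) \<partial>lborel)"
    by (intro nn_integral_cong) (simp add: G indicator_def)
  also have "\<dots> = (\<integral>\<^sup>+ t. G (x, exp t) * ennreal (exp t) \<partial>lborel)"
    by (rule nn_integral_exp_subst) measurable
  finally show "(\<integral>\<^sup>+ y\<in>{0<..}. g (x, y) \<partial>lborel) = (\<integral>\<^sup>+ t. g (x, exp t) * ennreal (exp t) \<partial>lborel)"
    by (simp add: G)
  have "(\<integral>\<^sup>+ y\<in>{0<..}. g (y, x) \<partial>lborel) = (\<integral>\<^sup>+ y\<in>{0<..}. G (y, x) \<partial>lborel)"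
    by (intro nn_integral_cong) (simp add: G indicator_def)
  also have "\<dots> = (\<integral>\<^sup>+ t. G (exp t, x) * ennreal (exp t) \<partial>lborel)"
    by (rule nn_integral_exp_subst) measurable
  finally show "(\<integral>\<^sup>+ y\<in>{0<..}. g (y, x) \<partial>lborel) = (\<integral>\<^sup>+ t. g (exp t, x) * ennreal (exp t) \<partial>lborel)"
    by (simp add: G)
qed

lemma log_density:
  assumes M: "prob_space M" and d: "has_BVHCM_density M Z f"
  shows "bcm (\<lambda>s t. f (exp s, exp t))" (is "bcm ?F")
    and "f \<in> borel_measurable quadrant"
    and "(\<lambda>(s, t). f (exp s, exp t)) \<in> borel_measurable (borel \<Otimes>\<^sub>M borel)"
    and "(\<integral>\<^sup>+ s. \<integral>\<^sup>+ t. f (exp s, exp t) * ennreal (exp (s + t)) \<partial>lborel \<partial>lborel) = 1"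
    and "\<And>s t. 0 < f (exp s, exp t)"
proof -
  have d': "distr M quadrant Z = density quadrant f" and f: "f \<in> borel_measurable quadrant"
    and Z: "Z \<in> M \<rightarrow>\<^sub>M quadrant" and B: "BVHCM f"
    using d unfolding has_BVHCM_density_def distributed_def by auto
  show bcm: "bcm ?F" by (rule bcm_of_BVHCM[OF B])
  show "f \<in> borel_measurable quadrant" by (rule f)
  show "(\<lambda>(s, t). f (exp s, exp t)) \<in> borel_measurable (borel \<Otimes>\<^sub>M borel)"
    by (rule measurable_log_coordinates[OF f])
  have "(\<integral>\<^sup>+ z. f z \<partial>quadrant) = emeasure (density quadrant f) (space quadrant)"
    using f by (subst emeasure_density) (auto intro!: nn_integral_cong)
  also have "\<dots> = 1"
    using prob_space.emeasure_space_1[OF prob_space.prob_space_distr[OF M Z]] d' by simp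
  finally show one: "(\<integral>\<^sup>+ s. \<integral>\<^sup>+ t. f (exp s, exp t) * ennreal (exp (s + t)) \<partial>lborel \<partial>lborel) = 1"
    unfolding nn_integral_quadrant[OF f] .
  \<comment> \<open>Total mass 1 excludes the zero function, and one positive value suffices for
    \<open>bcm_pos\<close>.\<close>
  obtain s0 t0 where "0 < ?F s0 t0"
  proof (rule ccontr)
    assume "\<not> thesis"
    then have "?F s t = 0" for s t using that[of s t] by (auto simp: zero_less_iff_neq_zero)
    then show False using one by simp
  qed
  then show "0 < f (exp s, exp t)" for s t
    by (rule bcm_pos[OF bcm])
qed

text \<open>The quotient density is the marginal density of \<open>f (x / y, 1 / y) * y powr (- 3)\<close>, which is again BVHCM
  since the substitution only permutes the three arguments.\<close>

lemma quotient_ucm: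
  assumes F: "bcm F" and [measurable]: "(\<lambda>(s, t). F s t) \<in> borel_measurable (borel \<Otimes>\<^sub>M borel)"
    and pos: "\<And>s t. 0 < F s t"
    and fin: "(\<integral>\<^sup>+ s. \<integral>\<^sup>+ t. F s t * ennreal (exp (s + t)) \<partial>lborel \<partial>lborel) < \<infinity>"
  shows "ucm (\<lambda>s. \<integral>\<^sup>+ t. F (s + t) t * ennreal (exp (2 * t)) \<partial>lborel)"
proof -
  \<comment> \<open>The exponent - 3 is the Jacobian of (x, y) -> (x / y, 1 / y). If F comes from
    the density of (X, Y), then G comes from that of (X / Y, 1 / Y); so its double integral is again
    finite and its first marginal is the quotient density.\<close>
  define G where "G s t = ennreal (1 * exp (0 * s + (- 3) * t)) * F (s - t) (- t)" for s t
  have G: "bcm G"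
    unfolding G_def[abs_def] by (intro bcm_weight bcm_shear F) simp
  have Gm [measurable]: "(\<lambda>(s, t). G s t) \<in> borel_measurable (borel \<Otimes>\<^sub>M borel)"
    unfolding G_def by measurable
  have "(\<integral>\<^sup>+ s. \<integral>\<^sup>+ t. G s t * ennreal (exp (s + t)) \<partial>lborel \<partial>lborel) =
    (\<integral>\<^sup>+ t. \<integral>\<^sup>+ s. G s t * ennreal (exp (s + t)) \<partial>lborel \<partial>lborel)"
    by (rule lborel_pair.Fubini'[symmetric]) measurable
  also have "\<dots> = (\<integral>\<^sup>+ t. \<integral>\<^sup>+ s. F s (- t) * ennreal (exp (s + - t)) \<partial>lborel \<partial>lborel)"
  proof (rule nn_integral_cong)
    fix t :: real
    have "(\<integral>\<^sup>+ s. G s t * ennreal (exp (s + t)) \<partial>lborel) = (\<integral>\<^sup>+ s. G (t + s) t * ennreal (exp ((t + s) + t)) \<partial>lborel)"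
      by (rule nn_integral_shift[symmetric]) measurable
    also have "\<dots> = (\<integral>\<^sup>+ s. F s (- t) * ennreal (exp (s + - t)) \<partial>lborel)"
    proof (rule nn_integral_cong)
      fix s :: real
      have "exp (- 3 * t) * exp ((t + s) + t) = exp (s + - t)"
        by (simp add: exp_add[symmetric])
      then have "ennreal (exp (- 3 * t)) * ennreal (exp ((t + s) + t)) = ennreal (exp (s + - t))"
        by (simp add: ennreal_mult[symmetric])
      then show "G (t + s) t * ennreal (exp ((t + s) + t)) = F s (- t) * ennreal (exp (s + - t))"
        unfolding G_def by (simp add: mult_ac)
    qed
    finally show "(\<integral>\<^sup>+ s. G s t * ennreal (exp (s + t)) \<partial>lborel) = (\<integral>\<^sup>+ s. F s (- t) * ennreal (exp (s + - t)) \<partial>lborel)" .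
  qed
  also have "\<dots> = (\<integral>\<^sup>+ t. \<integral>\<^sup>+ s. F s t * ennreal (exp (s + t)) \<partial>lborel \<partial>lborel)"
    by (rule nn_integral_reflect[of "\<lambda>t. \<integral>\<^sup>+ s. F s t * ennreal (exp (s + t)) \<partial>lborel"]) measurable
  also have "\<dots> = (\<integral>\<^sup>+ s. \<integral>\<^sup>+ t. F s t * ennreal (exp (s + t)) \<partial>lborel \<partial>lborel)"
    by (rule lborel_pair.Fubini') measurable
  finally have finG: "(\<integral>\<^sup>+ s. \<integral>\<^sup>+ t. G s t * ennreal (exp (s + t)) \<partial>lborel \<partial>lborel) < \<infinity>"
    using fin by simp
  have posG: "0 < G s t" for s t
    using pos[of "s - t" "- t"] by (simp add: G_def ennreal_zero_less_mult_iff)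
  have "ucm (\<lambda>s. \<integral>\<^sup>+ t. G s t * ennreal (exp t) \<partial>lborel)"
    by (intro marginal_ucm G Gm bcm_section_integral_finite posG finG)
  moreover have "(\<integral>\<^sup>+ t. G s t * ennreal (exp t) \<partial>lborel) = (\<integral>\<^sup>+ t. F (s + t) t * ennreal (exp (2 * t)) \<partial>lborel)" for s
  proof -
    have "(\<integral>\<^sup>+ t. G s t * ennreal (exp t) \<partial>lborel) = (\<integral>\<^sup>+ t. G s (- t) * ennreal (exp (- t)) \<partial>lborel)"
      by (rule nn_integral_reflect[symmetric]) measurable
    also have "\<dots> = (\<integral>\<^sup>+ t. F (s + t) t * ennreal (exp (2 * t)) \<partial>lborel)"
    proof (rule nn_integral_cong)
      fix t :: real
      have "exp (3 * t) * exp (- t) = exp (2 * t)" by (simp add: exp_add[symmetric])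
      then have e: "ennreal (exp (2 * t)) = ennreal (exp (3 * t)) * ennreal (exp (- t))"
        by (simp add: ennreal_mult[symmetric])
      have "G s (- t) = ennreal (exp (3 * t)) * F (s + t) t"
        by (simp add: G_def)
      then show "G s (- t) * ennreal (exp (- t)) = F (s + t) t * ennreal (exp (2 * t))"
        unfolding e by (simp only: mult_ac)
    qed
    finally show ?thesis .
  qed
  ultimately show ?thesis by simp
qed

section \<open>Conditional, marginal and quotient densities\<close>

lemma densities_HCM:
  assumes M: "prob_space M" and d: "has_BVHCM_density M Z f"
  shows "0 < y \<Longrightarrow> (\<integral>\<^sup>+ x\<in>{0<..}. conditional_density f y x \<partial>lborel) = 1"
    and "0 < y \<Longrightarrow> HCM (conditional_density f y)"
    and "HCM (marginal_density f)"
    and "HCM (quotient_density f)"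
proof -
  note L = log_density[OF M d]
  note [measurable] = L(3)
  let ?F = "\<lambda>s t. f (exp s, exp t)"
  have fin: "(\<integral>\<^sup>+ s. \<integral>\<^sup>+ t. ?F s t * ennreal (exp (s + t)) \<partial>lborel \<partial>lborel) < \<infinity>"
    using L(4) by simp
  have "(\<integral>\<^sup>+ s. \<integral>\<^sup>+ t. ?F t s * ennreal (exp (s + t)) \<partial>lborel \<partial>lborel) = 
     (\<integral>\<^sup>+ s. \<integral>\<^sup>+ t. ?F s t * ennreal (exp (t + s)) \<partial>lborel \<partial>lborel)"
    by (rule lborel_pair.Fubini') measurable
  then have fin': "(\<integral>\<^sup>+ s. \<integral>\<^sup>+ t. ?F t s * ennreal (exp (s + t)) \<partial>lborel \<partial>lborel) < \<infinity>"
    using fin by (simp add: add.commute)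
  show "HCM (marginal_density f)"
  proof (rule HCM_of_ucm)
    show "ucm (\<lambda>s. \<integral>\<^sup>+ t. ?F s t * ennreal (exp t) \<partial>lborel)"
      by (intro marginal_ucm L(1,3) bcm_section_integral_finite[OF L(1) L(3) L(5) fin])
    show "marginal_density f (exp s) = (\<integral>\<^sup>+ t. ?F s t * ennreal (exp t) \<partial>lborel)" for s
      unfolding marginal_density_def by (rule nn_integral_section_log(1)[OF L(2)]) simp
  qed
  show "HCM (quotient_density f)"
  proof (rule HCM_of_ucm)
    show "ucm (\<lambda>s. \<integral>\<^sup>+ t. ?F (s + t) t * ennreal (exp (2 * t)) \<partial>lborel)"
      by (rule quotient_ucm[OF L(1) L(3) L(5) fin])
    fix s :: real
    define G where "G z = f z * indicator ({0<..} \<times> {0<..}) z" for z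
    have [measurable]: "G \<in> borel_measurable (borel \<Otimes>\<^sub>M borel)"
      unfolding G_def by (rule quadrant_extend[OF L(2)])
    have G: "G (exp s * y, y) = f (exp s * y, y)" if "0 < y" for y
      using that by (simp add: G_def)
    have "quotient_density f (exp s) = (\<integral>\<^sup>+ y\<in>{0<..}. ennreal y * G (exp s * y, y) \<partial>lborel)"
      unfolding quotient_density_def by (intro nn_integral_cong) (simp add: G indicator_def)
    also have "\<dots> = (\<integral>\<^sup>+ t. ennreal (exp t) * G (exp s * exp t, exp t) * ennreal (exp t) \<partial>lborel)"
      by (rule nn_integral_exp_subst) measurable
    also have "\<dots> = (\<integral>\<^sup>+ t. ?F (s + t) t * ennreal (exp (2 * t)) \<partial>lborel)"
    proof (rule nn_integral_cong)
      fix t :: real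
      have "ennreal (exp (2 * t)) = ennreal (exp t) * ennreal (exp t)"
        by (simp add: ennreal_mult[symmetric] exp_add[symmetric])
      then show "ennreal (exp t) * G (exp s * exp t, exp t) * ennreal (exp t) = ?F (s + t) t * ennreal (exp (2 * t))"
        by (simp add: G exp_add mult_ac)
    qed
    finally show "quotient_density f (exp s) = (\<integral>\<^sup>+ t. ?F (s + t) t * ennreal (exp (2 * t)) \<partial>lborel)" .
  qed
  assume y: "0 < y"
  define N where "N = (\<integral>\<^sup>+ t\<in>{0<..}. f (t, y) \<partial>lborel)"
  have N_eq: "N = (\<integral>\<^sup>+ s. ?F s (ln y) * ennreal (exp s) \<partial>lborel)"
    unfolding N_def using nn_integral_section_log(2)[OF L(2) y] y by simp
  \<comment> \<open>In \<open>ennreal\<close>, an infinite \<open>N\<close> would make the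
    conditional density vanish identically and \<open>N = 0\<close> would make it infinite.
    Finiteness is that of a marginal with the coordinates exchanged.\<close>
  have "N < \<infinity>"
    unfolding N_eq
    by (rule bcm_section_integral_finite[OF bcm_swap[OF L(1)] _ L(5) fin']) measurable
  moreover have "N \<noteq> 0"
  proof
    assume "N = 0"
    then have "AE s in lborel. ?F s (ln y) * ennreal (exp s) = 0"
      unfolding N_eq by (subst (asm) nn_integral_0_iff_AE) measurable
    then have "AE s in lborel :: real measure. False"
      using L(5) by (auto elim!: eventually_mono simp: zero_less_iff_neq_zero)
    then show False by (simp add: ae_filter_eq_bot_iff)
  qed
  ultimately have N: "N \<noteq> 0" "N < \<infinity>" "inverse N < \<infinity>"
    by (auto simp: ennreal_inverse_eq_top_iff top.not_eq_extremum[symmetric])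
  have cond: "conditional_density f y x = f (x, y) * inverse N" for x
    by (simp add: conditional_density_def N_def divide_ennreal_def)
  show "(\<integral>\<^sup>+ x\<in>{0<..}. conditional_density f y x \<partial>lborel) = 1"
  proof -
    define g where "g = (\<lambda>z. f z * inverse N)"
    have g: "g \<in> borel_measurable quadrant" unfolding g_def using L(2) by measurable
    have "(\<integral>\<^sup>+ x\<in>{0<..}. conditional_density f y x \<partial>lborel) = (\<integral>\<^sup>+ x\<in>{0<..}. g (x, y) \<partial>lborel)"
      by (simp add: cond g_def)
    also have "\<dots> = (\<integral>\<^sup>+ s. ?F s (ln y) * ennreal (exp s) * inverse N \<partial>lborel)"
      using nn_integral_section_log(2)[OF g y] y by (simp add: g_def mult_ac)
    also have "\<dots> = N * inverse N"
      unfolding N_eq by (rule nn_integral_multc) measurable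
    also have "\<dots> = 1"
      using N by (simp add: divide_ennreal_def[symmetric] ennreal_divide_self)
    finally show ?thesis .
  qed
  show "HCM (conditional_density f y)"
  proof (rule HCM_of_ucm)
    show "ucm (\<lambda>s. ?F s (ln y) * inverse N)"
      by (rule ucm_cmult[OF section_ucm[OF L(1)] N(3)])
    show "conditional_density f y (exp s) = ?F s (ln y) * inverse N" for s
      using y by (simp add: cond)
  qed
qed

section \<open>Powers and inverses of random vectors\<close>

lemma BVHCM_vector_cong:
  assumes eq: "\<And>\<omega>. \<omega> \<in> space M \<Longrightarrow> Z \<omega> = Z' \<omega>" and v: "BVHCM_vector M Z"
  shows "BVHCM_vector M Z'"
proof -
  have "distr M quadrant Z = distr M quadrant Z'" using eq by (intro distr_cong) auto
  moreover have "Z \<in> M \<rightarrow>\<^sub>M quadrant \<longleftrightarrow> Z' \<in> M \<rightarrow>\<^sub>M quadrant" using eq by (rule measurable_cong)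
  ultimately show ?thesis
    using v unfolding BVHCM_vector_def has_BVHCM_density_def distributed_def by auto
qed

lemma bcm_scale_abs:
  assumes F: "bcm F" and p: "p \<noteq> 0" "\<bar>p\<bar> \<le> 1"
  shows "bcm (\<lambda>s t. F (p * s) (p * t))"
proof (cases "0 < p")
  case True
  then show ?thesis using bcm_scale[OF F] p by simp
next
  case False
  then show ?thesis using bcm_reflect[OF bcm_scale[OF F, of "- p"]] p by simp
qed

text \<open>With p = 1 / q the new density is f at (x^p, y^p) times the Jacobian. In logarithmic
  coordinates this is a dilation by p, with |p| \<le> 1, followed by an exponential weight, and both
  operations preserve \<open>bcm\<close>.\<close>

lemma BVHCM_vector_powr:
  assumes M: "prob_space M" and v: "BVHCM_vector M (\<lambda>\<omega>. (X \<omega>, Y \<omega>))" and q: "1 \<le> \<bar>q\<bar>"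
  shows "BVHCM_vector M (\<lambda>\<omega>. (X \<omega> powr q, Y \<omega> powr q))"
proof -
  let ?Z = "\<lambda>\<omega>. (X \<omega>, Y \<omega>)"
  obtain f where d: "has_BVHCM_density M ?Z f"
    using v unfolding BVHCM_vector_def by blast
  note L = log_density[OF M d]
  note [measurable] = L(2,3)
  define p where "p = 1 / q"
  have p: "p \<noteq> 0" "\<bar>p\<bar> \<le> 1" "q * p = 1" using q by (auto simp: p_def)
  define T :: "real \<Rightarrow> real \<times> real \<Rightarrow> real \<times> real" where "T r = (\<lambda>(x, y). (x powr r, y powr r))" for r
  have T_exp: "T r (exp s, exp t) = (exp (r * s), exp (r * t))" for r s t
    by (simp add: T_def exp_powr_real mult.commute)
  have id: "(\<lambda>z. z) \<in> quadrant \<rightarrow>\<^sub>M borel \<Otimes>\<^sub>M borel"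
    unfolding quadrant_def borel_prod by (rule measurable_restrict_space1) simp
  have "T r \<in> quadrant \<rightarrow>\<^sub>M borel \<Otimes>\<^sub>M borel" for r
    using measurable_compose[OF id, of "T r" "borel \<Otimes>\<^sub>M borel"] unfolding T_def by simp
  then have T [measurable]: "T r \<in> quadrant \<rightarrow>\<^sub>M quadrant" for r
    unfolding borel_prod by (subst (2) quadrant_def, intro measurable_restrict_space2)
      (auto simp: space_quadrant T_def)
  have Z [measurable]: "?Z \<in> M \<rightarrow>\<^sub>M quadrant" and distr_Z: "distr M quadrant ?Z = density quadrant f"
    using d unfolding has_BVHCM_density_def distributed_def by auto
  \<comment> \<open>The Jacobian determinant of \<open>T p\<close>; its constant |p| |p| =
    \<open>p\<^sup>2\<close> serves both signs of q.\<close>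
  define w where "w = (\<lambda>(x, y). ennreal (p\<^sup>2 * (x powr (p - 1) * y powr (p - 1))))"
  have [measurable]: "w \<in> borel_measurable quadrant"
    using measurable_compose[OF id, of w borel] unfolding w_def by simp
  define g where "g z = w z * f (T p z)" for z
  have g [measurable]: "g \<in> borel_measurable quadrant"
    unfolding g_def by measurable
  have w_exp: "w (exp s, exp t) = ennreal (p\<^sup>2 * exp ((p - 1) * s + (p - 1) * t))" for s t
    by (simp add: w_def exp_powr_real exp_add mult.commute)
  have "BVHCM g"
  proof (rule BVHCM_of_bcm)
    show "bcm (\<lambda>s t. ennreal (p\<^sup>2 * exp ((p - 1) * s + (p - 1) * t)) * f (exp (p * s), exp (p * t)))"
      by (rule bcm_weight[OF bcm_scale_abs[OF L(1) p(1,2)]]) simp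
    show "g (exp s, exp t) = ennreal (p\<^sup>2 * exp ((p - 1) * s + (p - 1) * t)) * f (exp (p * s), exp (p * t))" for s t
      by (simp add: g_def T_exp w_exp)
  qed
  moreover have "distributed M quadrant (\<lambda>\<omega>. T q (?Z \<omega>)) g"
    unfolding distributed_def
  proof (intro conjI)
    have "distr M quadrant (\<lambda>\<omega>. T q (?Z \<omega>)) = distr (density quadrant f) quadrant (T q)"
      unfolding distr_Z[symmetric] by (subst distr_distr) (auto simp: o_def)
    also have "\<dots> = density quadrant g"
    proof (rule measure_eqI)
      fix A assume "A \<in> sets (distr (density quadrant f) quadrant (T q))"
      then have A [measurable]: "A \<in> sets quadrant" by simp
      define h where "h z = f z * indicator A (T q z)" for z
      have h [measurable]: "h \<in> borel_measurable quadrant" unfolding h_def by measurable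
      let ?H = "\<lambda>s t. h (exp s, exp t) * ennreal (exp (s + t))"
      have Hm [measurable]: "(\<lambda>(s, t). h (exp s, exp t)) \<in> borel_measurable (borel \<Otimes>\<^sub>M borel)"
        by (rule measurable_log_coordinates[OF h])
      have "emeasure (distr (density quadrant f) quadrant (T q)) A =
          emeasure (density quadrant f) (T q -` A \<inter> space quadrant)"
        by (subst emeasure_distr) auto
      also have "\<dots> = (\<integral>\<^sup>+ z. f z * indicator (T q -` A \<inter> space quadrant) z \<partial>quadrant)"
        by (rule emeasure_density) measurable
      also have "\<dots> = (\<integral>\<^sup>+ z. h z \<partial>quadrant)"
        by (intro nn_integral_cong) (auto simp: h_def indicator_def)
      also have "\<dots> = (\<integral>\<^sup>+ s. \<integral>\<^sup>+ t. ?H s t \<partial>lborel \<partial>lborel)"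
        by (rule nn_integral_quadrant[OF h])
      \<comment> \<open>In logarithmic coordinates \<open>T q\<close> is multiplication by q, so the
        change of variables consists of two affine substitutions with factor |p| each.\<close>
      also have "\<dots> = \<bar>p\<bar> * (\<integral>\<^sup>+ s. \<integral>\<^sup>+ t. ?H (0 + p * s) t \<partial>lborel \<partial>lborel)"
        by (rule nn_integral_real_affine[OF _ p(1)]) measurable
      also have "\<dots> = \<bar>p\<bar> * (\<integral>\<^sup>+ s. \<bar>p\<bar> * (\<integral>\<^sup>+ t. ?H (0 + p * s) (0 + p * t) \<partial>lborel) \<partial>lborel)"
        by (intro arg_cong2[where f="(*)"] refl nn_integral_cong nn_integral_real_affine[OF _ p(1)]) measurable
      also have "\<dots> = (\<integral>\<^sup>+ s. \<bar>p\<bar> * (\<bar>p\<bar> * (\<integral>\<^sup>+ t. ?H (0 + p * s) (0 + p * t) \<partial>lborel)) \<partial>lborel)"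
        by (rule nn_integral_cmult[symmetric]) measurable
      also have "\<dots> = (\<integral>\<^sup>+ s. \<integral>\<^sup>+ t. ennreal (p\<^sup>2) * ?H (0 + p * s) (0 + p * t) \<partial>lborel \<partial>lborel)"
        by (subst nn_integral_cmult)
          (auto simp: mult.assoc[symmetric] ennreal_mult[symmetric] power2_eq_square)
      also have "\<dots> = (\<integral>\<^sup>+ s. \<integral>\<^sup>+ t. g (exp s, exp t) * indicator A (exp s, exp t) * ennreal (exp (s + t)) \<partial>lborel \<partial>lborel)"
      proof (intro nn_integral_cong)
        fix s t :: real
        have "p\<^sup>2 * exp ((p - 1) * s + (p - 1) * t) * exp (s + t) = p\<^sup>2 * exp (p * s + p * t)"
          by (simp add: exp_add[symmetric] algebra_simps)
        then have e: "ennreal (p\<^sup>2) * ennreal (exp (p * s + p * t)) =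
            ennreal (p\<^sup>2 * exp ((p - 1) * s + (p - 1) * t)) * ennreal (exp (s + t))"
          by (simp only: ennreal_mult[symmetric] zero_le_power2 exp_ge_zero mult_nonneg_nonneg)
        have "q * (p * s) = s" "q * (p * t) = t"
          using p(3) by (simp_all only: mult.assoc[symmetric] mult_1_left)
        then have h_exp: "h (exp (p * s), exp (p * t)) = f (exp (p * s), exp (p * t)) * indicator A (exp s, exp t)"
          by (simp only: h_def T_exp)
        have "ennreal (p\<^sup>2) * ?H (0 + p * s) (0 + p * t) =
            (ennreal (p\<^sup>2) * ennreal (exp (p * s + p * t))) * h (exp (p * s), exp (p * t))"
          by (simp only: add_0_left mult_ac)
        also have "\<dots> = g (exp s, exp t) * indicator A (exp s, exp t) * ennreal (exp (s + t))"
          unfolding e h_exp g_def T_exp w_exp by (simp only: mult_ac)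
        finally show "ennreal (p\<^sup>2) * ?H (0 + p * s) (0 + p * t) =
            g (exp s, exp t) * indicator A (exp s, exp t) * ennreal (exp (s + t))" .
      qed
      also have "\<dots> = (\<integral>\<^sup>+ z. g z * indicator A z \<partial>quadrant)"
        by (rule nn_integral_quadrant[symmetric]) measurable
      also have "\<dots> = emeasure (density quadrant g) A"
        by (rule emeasure_density[symmetric]) measurable
      finally show "emeasure (distr (density quadrant f) quadrant (T q)) A = emeasure (density quadrant g) A" .
    qed simp
    finally show "distr M quadrant (\<lambda>\<omega>. T q (?Z \<omega>)) = density quadrant g" .
    show "(\<lambda>\<omega>. T q (?Z \<omega>)) \<in> M \<rightarrow>\<^sub>M quadrant" by measurable
  qed (rule g)
  ultimately have "BVHCM_vector M (\<lambda>\<omega>. T q (?Z \<omega>))"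
    unfolding BVHCM_vector_def has_BVHCM_density_def by blast
  then show ?thesis by (simp add: T_def)
qed

text \<open>This is the case q = - 1: on the quadrant, where all values of the vector lie,
  \<open>powr - 1\<close> agrees with \<open>inverse\<close>.\<close>

lemma BVHCM_vector_inverse:
  assumes M: "prob_space M" and v: "BVHCM_vector M (\<lambda>\<omega>. (X \<omega>, Y \<omega>))"
  shows "BVHCM_vector M (\<lambda>\<omega>. (inverse (X \<omega>), inverse (Y \<omega>)))"
proof (rule BVHCM_vector_cong[OF _ BVHCM_vector_powr[OF M v, of "-1"]])
  fix \<omega> assume "\<omega> \<in> space M"
  moreover have "(\<lambda>\<omega>. (X \<omega>, Y \<omega>)) \<in> M \<rightarrow>\<^sub>M quadrant"
    using v unfolding BVHCM_vector_def has_BVHCM_density_def distributed_def by blast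
  ultimately have "(X \<omega>, Y \<omega>) \<in> {0<..} \<times> {0<..}"
    using measurable_space[of "\<lambda>\<omega>. (X \<omega>, Y \<omega>)" M quadrant \<omega>] space_quadrant by simp
  then show "(X \<omega> powr - 1, Y \<omega> powr - 1) = (inverse (X \<omega>), inverse (Y \<omega>))"
    by (simp add: powr_minus powr_one)
qed simp

theorem proposition3p1:
  fixes M :: "'a measure" and X Y :: "'a \<Rightarrow> real"
  assumes "prob_space M"
  shows "(\<forall>f. has_BVHCM_density M (\<lambda>\<omega>. (X \<omega>, Y \<omega>)) f \<longrightarrow>
            (\<forall>y>0. (\<integral>\<^sup>+ x\<in>{0<..}. conditional_density f y x \<partial>lborel) = 1 \<and>
                   HCM (conditional_density f y)) \<and>
            HCM (marginal_density f) \<and>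
            HCM (quotient_density f)) \<and>
         (BVHCM_vector M (\<lambda>\<omega>. (X \<omega>, Y \<omega>)) \<longrightarrow>
            BVHCM_vector M (\<lambda>\<omega>. (inverse (X \<omega>), inverse (Y \<omega>)))) \<and>
         (BVHCM_vector M (\<lambda>\<omega>. (X \<omega>, Y \<omega>)) \<longrightarrow>
            (\<forall>q::real. \<bar>q\<bar> \<ge> 1 \<longrightarrow> BVHCM_vector M (\<lambda>\<omega>. (X \<omega> powr q, Y \<omega> powr q))))"
proof (intro conjI allI impI)
  fix f and y :: real
  assume d: "has_BVHCM_density M (\<lambda>\<omega>. (X \<omega>, Y \<omega>)) f"
  show "HCM (marginal_density f)" "HCM (quotient_density f)"
    using densities_HCM(3,4)[OF assms d] .
  assume "0 < y"
  then show "(\<integral>\<^sup>+ x\<in>{0<..}. conditional_density f y x \<partial>lborel) = 1" "HCM (conditional_density f y)"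
    using densities_HCM(1,2)[OF assms d] by auto
next
  assume v: "BVHCM_vector M (\<lambda>\<omega>. (X \<omega>, Y \<omega>))"
  show "BVHCM_vector M (\<lambda>\<omega>. (inverse (X \<omega>), inverse (Y \<omega>)))"
    by (rule BVHCM_vector_inverse[OF assms v])
  fix q :: real
  assume "\<bar>q\<bar> \<ge> 1"
  then show "BVHCM_vector M (\<lambda>\<omega>. (X \<omega> powr q, Y \<omega> powr q))"
    by (rule BVHCM_vector_powr[OF assms v])
qed

end
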